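(* Let $\mathcal{G}=(V,E)$ be a finite tree of diameter $L\ge1$ and let $x_0\sim x_1\sim x_2\sim\cdots\sim x_L$ be a path in $\mathcal{G}$ of length $L$ (with distinct vertices). For $1\le k\le L-1$, remove the edges between $x_{k-1},x_k$ and between $x_k,x_{k+1}$ from $\mathcal{G}$, let $\mathcal{G}_k=(V_k,E_k)$ be the connected component containing $x_k$, and put $n_k:=|V_k\cap\delta\mathcal{G}|$. Then $\lambda_2(\mathcal{G})=\dfrac{2}{L}$ if and only if one of the following holds: (a) $L$ is odd and $n_k=0$ for all $1\le k\le L-1$, i.e. $\mathcal{G}$ is a path of length $L$; (b) $L$ is even, $n_k=0$ for all $1\le k\le L-1$ with $k\ne \frac L2$, and $\mathcal{G}=\mathcal{H}_1\cup\mathcal{H}_2$ with $\lambda_2\big((\mathcal{H}_2)^2_{x_{L/2}}\big)\ge\dfrac2L$, where $\mathcal{H}_1$ is the subgraph of $\mathcal{G}$ generated by the vertices $x_j$, $0\le j\le L$, and $\mathcal{H}_2=\mathcal{G}_{L/2}$.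
   Context: For a finite tree $\mathcal{G}=(V,E)$, the boundary $\delta\mathcal{G}$ is the set of vertices of degree one and $\Omega:=V\setminus\delta\mathcal{G}$ is the interior. For $f\in\mathbb{R}^V$, $\Delta f(x)=\sum_{y\sim x}(f(x)-f(y))$, and for $x\in\delta\mathcal{G}$ with its neighbor $y$, $\frac{\partial f}{\partial n}(x)=f(x)-f(y)$. A real $\lambda$ is a Steklov eigenvalue of $\mathcal{G}$ if there is a nonzero $f\in\mathbb{R}^V$ with $\Delta f=0$ on $\Omega$ and $\frac{\partial f}{\partial n}=\lambda f$ on $\delta\mathcal{G}$. Counted with multiplicity these are $0=\lambda_1<\lambda_2\le\dots\le\lambda_{|\delta\mathcal{G}|}$, and $\lambda_2(\mathcal{G})$ denotes the first nonzero one. For a tree $\mathcal{H}$ and a vertex $x$ of $\mathcal{H}$, $(\mathcal{H})^2_x$ denotes the wedge sum of $\mathcal{H}$ with an isomorphic copy $\mathcal{H}'$ of itself, obtained from the disjoint union of $\mathcal{H}$ and $\mathcal{H}'$ by identifying $x$ with its copy $x'$; its boundary is again its set of degree-one vertices. Convention: if $\mathcal{H}_2$ consists of a single vertex (i.e. $n_{L/2}=0$ and $\mathcal{G}$ is a path), the condition $\lambda_2((\mathcal{H}_2)^2_{x_{L/2}})\ge 2/L$ is regarded as satisfied. *)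

theory Defs
  imports "Graph_Theory.Graph_Theory"
begin

text \<open>
  A finite simple undirected graph is a digraph satisfying the locale \<open>graph\<close>: every undirected
  edge is a pair of opposite arcs.  The library predicate \<open>tree\<close> forbids the closed
  walk \<open>u, v, u\<close> as well, hence excludes every symmetric digraph with an edge; so only cycles with at
  least three arcs are forbidden here.
\<close>

definition finite_tree :: "('a, 'b) pre_digraph \<Rightarrow> bool" where
  "finite_tree G \<longleftrightarrow>
     graph G \<and> Digraph_Component.connected G \<and> \<not> (\<exists>p. pre_digraph.cycle G p \<and> length p \<ge> 3)"

definition graph_diameter :: "('a, 'b) pre_digraph \<Rightarrow> ereal" where
  "graph_diameter G = (SUP u\<in>verts G. SUP v\<in>verts G. wf_digraph.\<mu> G (\<lambda>_. 1) u v)"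

text \<open>In a symmetric digraph the out-degree of a vertex is its undirected degree.\<close>

definition boundary :: "('a, 'b) pre_digraph \<Rightarrow> 'a set" where
  "boundary G = {v \<in> verts G. out_degree G v = 1}"

definition interior_verts :: "('a, 'b) pre_digraph \<Rightarrow> 'a set" where
  "interior_verts G = verts G - boundary G"

definition laplacian :: "('a, 'b) pre_digraph \<Rightarrow> ('a \<Rightarrow> real) \<Rightarrow> 'a \<Rightarrow> real" where
  "laplacian G f x = (\<Sum>y\<in>{y. (x, y) \<in> arcs_ends G}. f x - f y)"

text \<open>Only meaningful at boundary vertices, where the neighbour is unique.\<close>

definition normal_derivative :: "('a, 'b) pre_digraph \<Rightarrow> ('a \<Rightarrow> real) \<Rightarrow> 'a \<Rightarrow> real" where
  "normal_derivative G f x = f x - f (THE y. (x, y) \<in> arcs_ends G)"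

definition steklov_eigenvalue :: "('a, 'b) pre_digraph \<Rightarrow> real \<Rightarrow> bool" where
  "steklov_eigenvalue G \<mu> \<longleftrightarrow>
     (\<exists>f :: 'a \<Rightarrow> real. (\<exists>x\<in>verts G. f x \<noteq> 0) \<and>
        (\<forall>x\<in>interior_verts G. laplacian G f x = 0) \<and>
        (\<forall>x\<in>boundary G. normal_derivative G f x = \<mu> * f x))"

text \<open>
  The first nonzero Steklov eigenvalue.  It exists for every finite tree with at least one edge;
  for a single vertex the boundary is empty and the value is meaningless.
\<close>

definition lambda2 :: "('a, 'b) pre_digraph \<Rightarrow> real" where
  "lambda2 G = (LEAST \<mu>. steklov_eigenvalue G \<mu> \<and> \<mu> \<noteq> 0)"

text \<open>
  The wedge sum at \<open>x\<close> of \<open>H\<close> with a copy of itself.  The first copy is tagged \<open>Inl\<close>, the second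
  \<open>Inr\<close>, except that the class \<open>{Inl x, Inr x}\<close> of identified base points is represented by \<open>Inl x\<close>.
\<close>

definition second_copy :: "'a \<Rightarrow> 'a \<Rightarrow> 'a + 'a" where
  "second_copy x v = (if v = x then Inl x else Inr v)"

definition wedge_double :: "('a, 'b) pre_digraph \<Rightarrow> 'a \<Rightarrow> ('a + 'a, 'b + 'b) pre_digraph" where
  "wedge_double H x =
     \<lparr> verts = Inl ` verts H \<union> second_copy x ` verts H,
       arcs = Inl ` arcs H \<union> Inr ` arcs H,
       tail = case_sum (\<lambda>e. Inl (tail H e)) (\<lambda>e. second_copy x (tail H e)),
       head = case_sum (\<lambda>e. Inl (head H e)) (\<lambda>e. second_copy x (head H e)) \<rparr>"

definition remove_path_edges ::
    "('a, 'b) pre_digraph \<Rightarrow> (nat \<Rightarrow> 'a) \<Rightarrow> nat \<Rightarrow> ('a, 'b) pre_digraph" where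
  "remove_path_edges G x k =
     \<lparr> verts = verts G,
       arcs = {e \<in> arcs G. {tail G e, head G e} \<noteq> {x (k - 1), x k} \<and>
                           {tail G e, head G e} \<noteq> {x k, x (k + 1)}},
       tail = tail G, head = head G \<rparr>"

text \<open>The component \<open>G\<^sub>k\<close>, for \<open>k\<close> with \<open>1 \<le> k \<le> L - 1\<close>.\<close>

definition path_component ::
    "('a, 'b) pre_digraph \<Rightarrow> (nat \<Rightarrow> 'a) \<Rightarrow> nat \<Rightarrow> ('a, 'b) pre_digraph" where
  "path_component G x k =
     (let H = remove_path_edges G x k in induce_subgraph H {v. reachable H (x k) v})"

text \<open>The boundary is that of the whole graph \<open>G\<close>, not of the component.\<close>

definition boundary_count :: "('a, 'b) pre_digraph \<Rightarrow> (nat \<Rightarrow> 'a) \<Rightarrow> nat \<Rightarrow> nat" where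
  "boundary_count G x k = card (verts (path_component G x k) \<inter> boundary G)"

definition path_graph_of_length :: "('a, 'b) pre_digraph \<Rightarrow> nat \<Rightarrow> bool" where
  "path_graph_of_length G L \<longleftrightarrow>
     (\<exists>y :: nat \<Rightarrow> 'a. bij_betw y {0..L} (verts G) \<and>
        (\<forall>i\<le>L. \<forall>j\<le>L. (y i, y j) \<in> arcs_ends G \<longleftrightarrow> j = i + 1 \<or> i = j + 1))"

end

theory Submission
  imports "HOL-Analysis.Function_Topology" "HOL-Analysis.Convex" Defs
begin

text \<open>
  The first nonzero Steklov eigenvalue is the best constant \<open>c\<close> in the Poincare inequality
  \<open>c \<Sum>\<^bsub>\<delta>G\<^esub> f\<^sup>2 \<le> E(f)\<close> for functions \<open>f\<close> of zero boundary sum, \<open>E\<close> being the Dirichlet energy.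
  Projecting the tree to the path gives a trial function of energy \<open>L\<close> whose boundary variance is at
  least \<open>L\<^sup>2 / 2\<close>, hence \<open>\<lambda>\<^sub>2 \<le> 2 / L\<close>; equality forces every boundary vertex other than the endpoints
  to project to the midpoint of the path.  In that situation the two half-paths, of length \<open>L / 2\<close>,
  contribute exactly the constant \<open>2 / L\<close>, so the Poincare inequality with this constant reduces to the
  one for functions on the middle component \<open>H\<close> vanishing at the base point.  Extending such functions
  to the double of \<open>H\<close> antisymmetrically shows that the latter inequality says
  \<open>\<lambda>\<^sub>2 \<ge> 2 / L\<close> for the double.
\<close>

section \<open>Dirichlet energy and Rayleigh quotients\<close>

text \<open>Write \<open>m\<close> for half of an even \<open>L\<close>. The zero-sum condition
  couples the middle component to the half-paths, and the reduction to \<open>dirichlet\<close> has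
  to undo this in both directions. Subtracting from a function of zero boundary sum its value at
  \<open>x m\<close> keeps the energy and can only enlarge the sum of squares; then the three pieces
  separate, and a half-path of \<open>m\<close> edges has constant \<open>1 / m\<close> by
  Cauchy-Schwarz. Conversely, a function on the component with a zero at \<open>x m\<close> and
  boundary sum \<open>s\<close> becomes admissible when a linear function with value
  \<open>-s\<close> at \<open>x 0\<close> is put on one half-path. This costs energy
  \<open>s^2 / m\<close> and adds the same amount to the weighted sum of squares, so the two cancel.
  The diameter enters through 1-Lipschitz functions, whose oscillation it bounds: this makes both
  ends of the path leaves. Acyclicity enters as the statement that every edge is a bridge. An
  undirected edge is two ordered pairs, hence the factor 1/2 in the energy.\<close>

definition energy :: "('a \<times> 'a) set \<Rightarrow> ('a \<Rightarrow> real) \<Rightarrow> real" where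
  "energy A f = (\<Sum>(u, v)\<in>A. (f u - f v)\<^sup>2) / 2"

definition poincare :: "('a \<times> 'a) set \<Rightarrow> 'a set \<Rightarrow> real \<Rightarrow> bool" where
  "poincare A D c \<longleftrightarrow> (\<forall>f. sum f D = 0 \<longrightarrow> c * (\<Sum>v\<in>D. (f v)\<^sup>2) \<le> energy A f)"

lemma poincareD:
  "poincare A D c \<Longrightarrow> sum f D = 0 \<Longrightarrow> c * (\<Sum>v\<in>D. (f v)\<^sup>2) \<le> energy A f"
  unfolding poincare_def by blast

lemma energy_nonneg: "0 \<le> energy A f"
  unfolding energy_def by (auto intro!: sum_nonneg)

lemma energy_scale: "energy A (\<lambda>v. c * f v) = c\<^sup>2 * energy A f"
proof -
  have "(\<lambda>(u, v). (c * f u - c * f v)\<^sup>2) = (\<lambda>p. c\<^sup>2 * (case p of (u, v) \<Rightarrow> (f u - f v)\<^sup>2))"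
    by (auto simp: fun_eq_iff power_mult_distrib[symmetric] algebra_simps)
  then show ?thesis
    unfolding energy_def by (simp add: sum_distrib_left[symmetric])
qed

lemma energy_shift: "energy A (\<lambda>v. f v - c) = energy A f"
  unfolding energy_def by simp

lemma energy_cong:
  assumes "\<And>u v. (u, v) \<in> A \<Longrightarrow> f u = g u \<and> f v = g v"
  shows "energy A f = energy A g"
  unfolding energy_def using assms by (auto intro!: sum.cong)

text \<open>The two orientations of the edge together cancel the factor 1/2; for a loop they
  coincide, but then the left side is zero.\<close>

lemma edge_le_energy:
  assumes "finite A" "sym A" "(u, v) \<in> A"
  shows "(f u - f v)\<^sup>2 \<le> energy A f"
proof (cases "u = v")
  case True
  then show ?thesis by (simp add: energy_nonneg)
next
  case False
  have "(\<Sum>(a, b)\<in>{(u, v), (v, u)}. (f a - f b)\<^sup>2) \<le> (\<Sum>(a, b)\<in>A. (f a - f b)\<^sup>2)"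
    using assms by (intro sum_mono2) (auto dest: symD)
  then show ?thesis
    using False by (simp add: energy_def power2_commute[of "f v"])
qed

text \<open>An edge changes a function of energy at most \<open>C\<close> by at most
  \<open>sqrt C\<close>, so bounds propagate along walks. The point is the order of quantifiers:
  \<open>K\<close> does not depend on \<open>f\<close>.\<close>

lemma bounded_by_energy:
  assumes "finite A" "sym A" "(b, v) \<in> A\<^sup>*"
  shows "\<exists>K. \<forall>f. energy A f \<le> C \<longrightarrow> \<bar>f b\<bar> \<le> 1 \<longrightarrow> \<bar>f v\<bar> \<le> K"
  using assms(3)
proof (induction rule: rtrancl_induct)
  case base
  then show ?case by blast
next
  case (step y z)
  then obtain K where K: "\<And>f. energy A f \<le> C \<Longrightarrow> \<bar>f b\<bar> \<le> 1 \<Longrightarrow> \<bar>f y\<bar> \<le> K"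
    by blast
  have "\<bar>f z\<bar> \<le> K + sqrt C" if f: "energy A f \<le> C" "\<bar>f b\<bar> \<le> 1" for f
  proof -
    have "(f y - f z)\<^sup>2 \<le> C"
      using edge_le_energy[OF assms(1,2) step(2), of f] f by linarith
    then have "\<bar>f y - f z\<bar> \<le> sqrt C"
      by (rule real_le_rsqrt[OF power2_abs[THEN eq_refl, THEN order_trans]])
    then show ?thesis using K[OF f] by linarith
  qed
  then show ?case by blast
qed

lemma constant_of_energy_zero:
  assumes "finite A" "sym A" "energy A f = 0" "(u, v) \<in> A\<^sup>*"
  shows "f u = f v"
  using assms(4)
proof (induction rule: rtrancl_induct)
  case (step y z)
  then show ?case
    using edge_le_energy[OF assms(1,2) step(2), of f] assms(3) by auto
qed simp

text \<open>Tychonoff: functions on the vertex type carry the product topology, so coordinatewise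
  bounds give compactness even over an infinite type.\<close>

lemma compact_box:
  fixes K :: "'a \<Rightarrow> real"
  shows "compact {f. \<forall>v. \<bar>f v\<bar> \<le> K v}"
proof -
  have "{f. \<forall>v. \<bar>f v\<bar> \<le> K v} = PiE UNIV (\<lambda>v. {-K v..K v})"
    by (auto simp: abs_le_iff PiE_def Pi_def) (metis minus_le_iff)+
  moreover have "compactin (product_topology (\<lambda>_. euclidean) UNIV) (PiE UNIV (\<lambda>v. {-K v..K v}))"
    by (subst compactin_PiE) auto
  ultimately show ?thesis
    by (simp add: euclidean_product_topology)
qed

lemma continuous_energy: "continuous_on S (energy A)"
proof -
  have "continuous_on S (\<lambda>f. f w)" for w :: 'a
    by (rule continuous_on_subset[OF continuous_on_product_coordinates]) simp
  then have "continuous_on S (\<lambda>f. (\<Sum>(u, v)\<in>A. (f u - f v)\<^sup>2) / 2)"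
    unfolding case_prod_unfold by (intro continuous_intros) auto
  then show ?thesis unfolding energy_def[abs_def] .
qed

text \<open>The direct method. Constraint and energy see only vertices in \<open>V\<close>, while
  functions live on the whole type; competitors are therefore set to zero outside \<open>V\<close>
  to land in a compact box.\<close>

lemma rayleigh_minimizer:
  assumes "finite V" "A \<subseteq> V \<times> V" "sym A"
    and conn: "\<And>u v. u \<in> V \<Longrightarrow> v \<in> V \<Longrightarrow> (u, v) \<in> A\<^sup>*"
    and "D \<subseteq> V" "card D \<ge> 2"
  obtains f where "sum f D = 0" "(\<Sum>v\<in>D. (f v)\<^sup>2) = 1" "poincare A D (energy A f)"
proof -
  have fin: "finite A" "finite D"
    using assms finite_subset by blast+
  define T where "T = {f :: 'a \<Rightarrow> real. sum f D = 0 \<and> (\<Sum>v\<in>D. (f v)\<^sup>2) = 1}"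
  obtain b b' where b: "b \<in> D" "b' \<in> D" "b \<noteq> b'"
    using \<open>card D \<ge> 2\<close> by (metis card_le_Suc0_iff_eq fin(2) not_less_eq_eq numeral_2_eq_2)
  \<comment> \<open>Any normalized function of zero sum would do: it shows \<open>T\<close> nonempty
    and fixes the energy level \<open>C\<close> below which the minimum is sought.\<close>
  define f\<^sub>0 where "f\<^sub>0 v = (if v = b then 1 / sqrt 2 else if v = b' then - 1 / sqrt 2 else 0)" for v
  have D: "D = insert b (insert b' (D - {b, b'}))"
    using b by auto
  have "f\<^sub>0 \<in> T"
    unfolding T_def mem_Collect_eq
    by (subst D, subst (2) D) (use b fin in \<open>simp add: f\<^sub>0_def power_divide\<close>)
  define C where "C = energy A f\<^sub>0"
  have "\<exists>K. \<forall>v\<in>V. \<forall>f. energy A f \<le> C \<longrightarrow> \<bar>f b\<bar> \<le> 1 \<longrightarrow> \<bar>f v\<bar> \<le> K v"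
    using bounded_by_energy[OF fin(1) assms(3) conn] b(1) \<open>D \<subseteq> V\<close> 
    by (intro bchoice) blast
  then obtain K where K: "\<And>v f. v \<in> V \<Longrightarrow> energy A f \<le> C \<Longrightarrow> \<bar>f b\<bar> \<le> 1 \<Longrightarrow> \<bar>f v\<bar> \<le> K v"
    by blast
  define B where "B = {f :: 'a \<Rightarrow> real. \<forall>v. \<bar>f v\<bar> \<le> (if v \<in> V then K v else 0)}"
  have "continuous_on UNIV (\<lambda>f :: 'a \<Rightarrow> real. f w)" for w
    by (rule continuous_on_product_coordinates)
  then have "closed {f :: 'a \<Rightarrow> real. sum f D = 0}" "closed {f :: 'a \<Rightarrow> real. (\<Sum>v\<in>D. (f v)\<^sup>2) = 1}"
    by (auto intro!: closed_Collect_eq continuous_intros)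
  then have "closed T"
    unfolding T_def by (rule closed_Collect_conj)
  then have comp: "compact (B \<inter> T)"
    unfolding B_def by (intro compact_Int_closed compact_box)
  \<comment> \<open>The normalization bounds the value at \<open>b\<close>, from which the bounds
    \<open>K\<close> propagate.\<close>
  have small: "\<bar>f b\<bar> \<le> 1" if "f \<in> T" for f
  proof -
    have "(f b)\<^sup>2 \<le> (\<Sum>v\<in>D. (f v)\<^sup>2)"
      using b fin by (intro member_le_sum) auto
    then show ?thesis using that by (simp add: T_def abs_square_le_1)
  qed
  have trunc: "\<exists>g\<in>B \<inter> T. energy A g = energy A f" if f: "f \<in> T" "energy A f \<le> C" for f
  proof
    define g where "g v = (if v \<in> V then f v else 0)" for v
    have "sum g D = sum f D" "(\<Sum>v\<in>D. (g v)\<^sup>2) = (\<Sum>v\<in>D. (f v)\<^sup>2)"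
      using \<open>D \<subseteq> V\<close> by (auto intro!: sum.cong simp: g_def)
    then show "g \<in> B \<inter> T"
      using f K[OF _ f(2) small[OF f(1)]] by (auto simp: T_def B_def g_def)
    show "energy A g = energy A f"
      using assms(2) by (intro energy_cong) (auto simp: g_def)
  qed
  have "B \<inter> T \<noteq> {}"
    using trunc[OF \<open>f\<^sub>0 \<in> T\<close>] C_def by auto
  from continuous_attains_inf[OF comp this continuous_energy]
  obtain f where f: "f \<in> B \<inter> T" and min: "\<And>g. g \<in> B \<inter> T \<Longrightarrow> energy A f \<le> energy A g"
    by metis
  have min': "energy A f \<le> energy A g" if "g \<in> T" for g
  proof (cases "energy A g \<le> C")
    case True
    then show ?thesis using trunc[OF that] min by fastforce
  next
    case False
    moreover have "energy A f \<le> C"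
      using trunc[OF \<open>f\<^sub>0 \<in> T\<close>] C_def min by fastforce
    ultimately show ?thesis by linarith
  qed
  have "poincare A D (energy A f)"
    unfolding poincare_def
  proof (intro allI impI)
    fix g :: "'a \<Rightarrow> real" assume g: "sum g D = 0"
    define s where "s = (\<Sum>v\<in>D. (g v)\<^sup>2)"
    have "s \<ge> 0" unfolding s_def by (simp add: sum_nonneg)
    show "energy A f * (\<Sum>v\<in>D. (g v)\<^sup>2) \<le> energy A g"
    proof (cases "s = 0")
      case True
      then show ?thesis by (simp add: s_def[symmetric] energy_nonneg)
    next
      case False
      with \<open>s \<ge> 0\<close> have "s > 0" by simp
      \<comment> \<open>Both sides are quadratic, so \<open>g\<close> may be rescaled to unit sum of
        squares.\<close>
      have "(\<lambda>v. 1 / sqrt s * g v) \<in> T"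
        unfolding T_def using g \<open>s > 0\<close>
        by (auto simp: sum_distrib_left[symmetric] power_divide sum_divide_distrib[symmetric] s_def[symmetric])
      from min'[OF this] have "energy A f \<le> energy A g / s"
        using \<open>s > 0\<close> unfolding energy_scale by (simp add: power_divide)
      then show ?thesis using \<open>s > 0\<close> by (simp add: s_def[symmetric] field_simps)
    qed
  qed
  then show ?thesis using f that by (auto simp: T_def)
qed

section \<open>The variational characterization of the first nonzero Steklov eigenvalue\<close>

lemma finite_arcs_ends: "finite (arcs G) \<Longrightarrow> finite (arcs_ends G)"
  by (simp add: arcs_ends_def)

lemma (in graph) sym_arcs_ends: "sym (arcs_ends G)"
  using sym_arcs by (simp add: symmetric_def)

lemma (in graph) out_degree_eq_card: "out_degree G v = card (arcs_ends G `` {v})"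
proof -
  have "arcs_ends G `` {v} = head G ` out_arcs G v"
    by (auto simp: arcs_ends_conv image_iff)
  moreover have "inj_on (head G) (out_arcs G v)"
    by (auto intro!: inj_onI no_multi_arcs simp: arc_to_ends_def)
  ultimately show ?thesis
    by (simp add: out_degree_def card_image)
qed

text \<open>At a vertex of degree one the Laplacian has a single term. Both Steklov conditions thus
  become one equation for the Laplacian on all vertices, the form that Green's formula
  needs.\<close>

lemma (in graph) normal_derivative_eq_laplacian:
  assumes "v \<in> boundary G"
  shows "normal_derivative G f v = laplacian G f v"
proof -
  have "card {y. (v, y) \<in> arcs_ends G} = 1"
    using assms by (simp add: boundary_def out_degree_eq_card Image_singleton)
  then obtain w where w: "{y. (v, y) \<in> arcs_ends G} = {w}"
    by (auto simp: card_1_singleton_iff)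
  then have "(THE y. (v, y) \<in> arcs_ends G) = w"
    by (intro the_equality) auto
  with w show ?thesis
    by (simp add: laplacian_def normal_derivative_def)
qed

lemma (in graph) steklov_eigenvalue_iff:
  "steklov_eigenvalue G \<nu> \<longleftrightarrow> (\<exists>f. (\<exists>v\<in>verts G. f v \<noteq> 0) \<and>
     (\<forall>v\<in>verts G. laplacian G f v = (if v \<in> boundary G then \<nu> * f v else 0)))"
proof -
  have "(\<forall>v\<in>interior_verts G. laplacian G f v = 0) \<and>
      (\<forall>v\<in>boundary G. normal_derivative G f v = \<nu> * f v) \<longleftrightarrow>
      (\<forall>v\<in>verts G. laplacian G f v = (if v \<in> boundary G then \<nu> * f v else 0))" for f
    by (auto simp: interior_verts_def normal_derivative_eq_laplacian)
       (auto simp: boundary_def)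
  then show ?thesis
    unfolding steklov_eigenvalue_def by (simp only:)
qed

text \<open>Summation by parts: reversing all arcs preserves the symmetric arc set and flips the
  sign of \<open>f u - f v\<close>, so the two terms of \<open>h u - h v\<close> contribute
  equally.\<close>

lemma (in graph) green:
  "(\<Sum>(u, v)\<in>arcs_ends G. (f u - f v) * (h u - h v)) / 2 = (\<Sum>u\<in>verts G. h u * laplacian G f u)"
proof -
  let ?A = "arcs_ends G"
  have fin: "finite ?A"
    by (simp add: finite_arcs_ends)
  have conv: "?A\<inverse> = ?A"
    using sym_arcs_ends by (simp add: sym_conv_converse_eq)
  have "(\<Sum>(u, v)\<in>?A. (f u - f v) * h v) = (\<Sum>(u, v)\<in>?A\<inverse>. (f v - f u) * h u)"
    by (rule sum.reindex_bij_witness[of _ prod.swap prod.swap]) auto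
  also have "\<dots> = - (\<Sum>(u, v)\<in>?A. (f u - f v) * h u)"
    unfolding conv sum_negf[symmetric] by (intro sum.cong) (auto simp: algebra_simps)
  finally have swap: "(\<Sum>(u, v)\<in>?A. (f u - f v) * h v) = - (\<Sum>(u, v)\<in>?A. (f u - f v) * h u)" .
  have "(\<Sum>(u, v)\<in>?A. (f u - f v) * (h u - h v))
      = (\<Sum>(u, v)\<in>?A. (f u - f v) * h u) - (\<Sum>(u, v)\<in>?A. (f u - f v) * h v)"
    unfolding sum_subtractf[symmetric] by (intro sum.cong) (auto simp: algebra_simps)
  then have "(\<Sum>(u, v)\<in>?A. (f u - f v) * (h u - h v)) / 2 = (\<Sum>(u, v)\<in>?A. (f u - f v) * h u)"
    using swap by simp
  also have "\<dots> = (\<Sum>(u, v)\<in>(SIGMA u:verts G. {v. (u, v) \<in> ?A}). (f u - f v) * h u)"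
    by (intro sum.cong) (auto dest: adj_in_verts)
  also have "\<dots> = (\<Sum>u\<in>verts G. \<Sum>v\<in>{v. (u, v) \<in> ?A}. (f u - f v) * h u)"
    using fin by (subst sum.Sigma) (auto intro: finite_subset[OF _ finite_verts] dest: adj_in_verts)
  also have "\<dots> = (\<Sum>u\<in>verts G. h u * laplacian G f u)"
    by (simp add: laplacian_def sum_distrib_left mult.commute)
  finally show ?thesis .
qed

lemma (in graph) energy_eq_green: "energy (arcs_ends G) f = (\<Sum>u\<in>verts G. f u * laplacian G f u)"
  unfolding green[symmetric] by (simp add: energy_def power2_eq_square)

text \<open>The first variation of a quadratic form vanishes at a minimizer.\<close>

lemma linear_coefficient_zero:
  fixes b c :: real
  assumes "\<And>t. 0 \<le> t * b + t\<^sup>2 * c"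
  shows "b = 0"
proof (rule ccontr)
  assume "b \<noteq> 0"
  define s where "s = \<bar>c\<bar> + 1"
  have s: "s > 0" "c < s" by (auto simp: s_def)
  have "(- b / s) * b + (- b / s)\<^sup>2 * c = (b / s)\<^sup>2 * (c - s)"
    using s by (simp add: power2_eq_square field_simps)
  moreover have "(b / s)\<^sup>2 * (c - s) < 0"
    using s \<open>b \<noteq> 0\<close> by (intro mult_pos_neg) auto
  ultimately show False
    using assms[of "- b / s"] by linarith
qed

text \<open>Euler-Lagrange: the first variation vanishes in every admissible direction, and a
  direction built from the indicator of \<open>w\<close> reads off the Laplacian at
  \<open>w\<close>.\<close>

lemma (in graph) minimizer_is_eigenfunction:
  assumes "boundary G \<noteq> {}"
    and f: "sum f (boundary G) = 0" "(\<Sum>v\<in>boundary G. (f v)\<^sup>2) = 1"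
    and poin: "poincare (arcs_ends G) (boundary G) (energy (arcs_ends G) f)"
    and w: "w \<in> verts G"
  shows "laplacian G f w = (if w \<in> boundary G then energy (arcs_ends G) f * f w else 0)"
proof -
  let ?A = "arcs_ends G" and ?D = "boundary G"
  define \<nu> where "\<nu> = energy ?A f"
  have finD: "finite ?D"
    by (simp add: boundary_def)
  \<comment> \<open>The boundary mean of the indicator of \<open>w\<close>; subtracting it gives
    \<open>h\<close> zero boundary sum.\<close>
  define k where "k = (if w \<in> ?D then 1 / real (card ?D) else 0)"
  define h where "h v = (if v = w then 1 else 0) - k" for v
  have zero: "sum h ?D = 0"
    using finD assms(1) by (simp add: h_def sum_subtractf k_def)
  \<comment> \<open>The shift by \<open>k\<close> drops out here because \<open>f\<close> has zero
    boundary sum, and below in \<open>E\<close> because only differences occur.\<close>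
  have fh: "(\<Sum>v\<in>?D. f v * h v) = (if w \<in> ?D then f w else 0)"
  proof -
    have "(\<Sum>v\<in>?D. f v * h v) = (\<Sum>v\<in>?D. if v = w then f v else 0) - k * sum f ?D"
      unfolding sum_distrib_left sum_subtractf[symmetric]
      by (intro sum.cong) (auto simp: h_def algebra_simps)
    then show ?thesis using f(1) finD by simp
  qed
  define E where "E = (\<Sum>(u, v)\<in>?A. (f u - f v) * (h u - h v)) / 2"
  have E: "E = laplacian G f w"
  proof -
    have "E = (\<Sum>(u, v)\<in>?A. (f u - f v) * ((if u = w then 1 else 0) - (if v = w then 1 else 0))) / 2"
      by (simp add: E_def h_def)
    also have "\<dots> = (\<Sum>u\<in>verts G. (if u = w then 1 else 0) * laplacian G f u)"
      by (rule green)
    also have "\<dots> = laplacian G f w"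
      using w by (simp add: if_distrib[of "\<lambda>x. x * _"] cong: if_cong)
    finally show ?thesis .
  qed
  have "0 \<le> t * (2 * E - 2 * \<nu> * (\<Sum>v\<in>?D. f v * h v))
      + t\<^sup>2 * (energy ?A h - \<nu> * (\<Sum>v\<in>?D. (h v)\<^sup>2))" for t
  proof -
    have "energy ?A (\<lambda>v. f v + t * h v) = \<nu> + 2 * t * E + t\<^sup>2 * energy ?A h"
      unfolding \<nu>_def energy_def E_def
      by (simp add: sum_distrib_left sum_divide_distrib sum.distrib[symmetric] case_prod_unfold
          power2_eq_square algebra_simps add_divide_distrib diff_divide_distrib)
    moreover have "(\<Sum>v\<in>?D. (f v + t * h v)\<^sup>2)
        = 1 + 2 * t * (\<Sum>v\<in>?D. f v * h v) + t\<^sup>2 * (\<Sum>v\<in>?D. (h v)\<^sup>2)"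
      unfolding f(2)[symmetric]
      by (simp add: sum_distrib_left sum.distrib[symmetric] power2_eq_square algebra_simps)
    moreover have "sum (\<lambda>v. f v + t * h v) ?D = 0"
      using f(1) zero by (simp add: sum.distrib sum_distrib_left[symmetric])
    then have "\<nu> * (\<Sum>v\<in>?D. (f v + t * h v)\<^sup>2) \<le> energy ?A (\<lambda>v. f v + t * h v)"
      using poincareD[OF poin] unfolding \<nu>_def by blast
    ultimately show ?thesis by (simp add: algebra_simps)
  qed
  from linear_coefficient_zero[OF this] show ?thesis
    using E fh by (simp add: \<nu>_def)
qed

text \<open>Testing the eigenvalue equation against constants gives zero boundary sum, since
  \<open>\<nu>\<close> is nonzero; testing it against \<open>f\<close> gives energy
  \<open>\<nu> * s\<close>. So \<open>f\<close> is admissible with Rayleigh quotient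
  \<open>\<nu>\<close>.\<close>

lemma (in graph) poincare_eigenvalue:
  assumes conn: "\<And>u v. u \<in> verts G \<Longrightarrow> v \<in> verts G \<Longrightarrow> (u, v) \<in> (arcs_ends G)\<^sup>*"
    and "boundary G \<noteq> {}"
    and "poincare (arcs_ends G) (boundary G) c" "steklov_eigenvalue G \<nu>" "\<nu> \<noteq> 0"
  shows "c \<le> \<nu>"
proof -
  let ?A = "arcs_ends G" and ?D = "boundary G"
  have D: "finite ?D" "?D \<subseteq> verts G"
    by (auto simp: boundary_def)
  obtain f where f: "\<exists>v\<in>verts G. f v \<noteq> 0"
      "\<And>v. v \<in> verts G \<Longrightarrow> laplacian G f v = (if v \<in> ?D then \<nu> * f v else 0)"
    using assms(4) unfolding steklov_eigenvalue_iff by metis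
  have weak: "(\<Sum>u\<in>verts G. h u * laplacian G f u) = \<nu> * (\<Sum>v\<in>?D. h v * f v)" for h
  proof -
    have "(\<Sum>u\<in>verts G. h u * laplacian G f u) = (\<Sum>u\<in>verts G. if u \<in> ?D then \<nu> * (h u * f u) else 0)"
      by (intro sum.cong) (auto simp: f(2))
    also have "\<dots> = (\<Sum>u\<in>?D. \<nu> * (h u * f u))"
      using D by (subst sum.inter_restrict[symmetric]) (auto simp: Int_absorb1)
    finally show ?thesis by (simp add: sum_distrib_left)
  qed
  have "\<nu> * sum f ?D = 0"
    using weak[of "\<lambda>_. 1"] green[of f "\<lambda>_. 1"] by simp
  then have mean: "sum f ?D = 0" using assms(5) by simp
  define s where "s = (\<Sum>v\<in>?D. (f v)\<^sup>2)"
  have en: "energy ?A f = \<nu> * s"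
    unfolding energy_eq_green weak s_def by (simp add: power2_eq_square)
  \<comment> \<open>An eigenfunction vanishing on the boundary would have energy zero, hence be
    constant and zero everywhere.\<close>
  have "s \<noteq> 0"
  proof
    assume "s = 0"
    then have "f v = 0" if "v \<in> ?D" for v
      using that D by (simp add: s_def sum_nonneg_eq_0_iff)
    moreover obtain b where "b \<in> ?D" using assms(2) by blast
    moreover have "f b = f v" if "v \<in> verts G" for v
      using en \<open>s = 0\<close> D(2) \<open>b \<in> ?D\<close> that
      by (intro constant_of_energy_zero[OF finite_arcs_ends[OF finite_arcs] sym_arcs_ends _ conn]) auto
    ultimately show False using f(1) by auto
  qed
  moreover have "s \<ge> 0" by (simp add: s_def sum_nonneg)
  moreover have "c * s \<le> \<nu> * s"
    using poincareD[OF assms(3) mean] unfolding en s_def .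
  ultimately show ?thesis by simp
qed

text \<open>The minimal Rayleigh quotient is attained, is a nonzero eigenvalue and bounds all
  nonzero eigenvalues from below, so the \<open>LEAST\<close> in \<open>lambda2\<close> is a genuine
  minimum. Being valid for every \<open>c\<close>, the equivalence determines
  \<open>lambda2\<close>.\<close>

lemma (in graph) lambda2_ge_iff:
  assumes conn: "\<And>u v. u \<in> verts G \<Longrightarrow> v \<in> verts G \<Longrightarrow> (u, v) \<in> (arcs_ends G)\<^sup>*"
    and two: "card (boundary G) \<ge> 2"
  shows "c \<le> lambda2 G \<longleftrightarrow> poincare (arcs_ends G) (boundary G) c"
proof -
  let ?A = "arcs_ends G" and ?D = "boundary G"
  have D: "?D \<subseteq> verts G" "?D \<noteq> {}"
    using two by (force simp: boundary_def, fastforce)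
  have A: "?A \<subseteq> verts G \<times> verts G"
    by (auto dest: adj_in_verts)
  obtain f where f: "sum f ?D = 0" "(\<Sum>v\<in>?D. (f v)\<^sup>2) = 1" "poincare ?A ?D (energy ?A f)"
    using rayleigh_minimizer[OF finite_verts A sym_arcs_ends conn D(1) two] by blast
  define \<nu> where "\<nu> = energy ?A f"
  have "\<exists>v\<in>verts G. f v \<noteq> 0"
  proof (rule ccontr)
    assume "\<not> ?thesis"
    then have "(\<Sum>v\<in>?D. (f v)\<^sup>2) = 0" using D(1) by (intro sum.neutral) auto
    then show False using f(2) by simp
  qed
  then have eig: "steklov_eigenvalue G \<nu>"
    unfolding steklov_eigenvalue_iff \<nu>_def
    using minimizer_is_eigenfunction[OF D(2) f] by blast
  \<comment> \<open>A minimizer of energy zero is constant on the boundary; zero sum makes it vanish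
    there, against the normalization.\<close>
  have "\<nu> \<noteq> 0"
  proof
    assume "\<nu> = 0"
    obtain b where b: "b \<in> ?D" using D(2) by blast
    have "f v = f b" if "v \<in> ?D" for v
      using \<open>\<nu> = 0\<close> that b D(1) unfolding \<nu>_def
      by (intro constant_of_energy_zero[OF finite_arcs_ends[OF finite_arcs] sym_arcs_ends _ conn]) auto
    then have const: "sum f ?D = real (card ?D) * f b" "(\<Sum>v\<in>?D. (f v)\<^sup>2) = real (card ?D) * (f b)\<^sup>2"
      by auto
    then have "f b = 0" using f(1) two by simp
    then show False using const f(2) by simp
  qed
  have "lambda2 G = \<nu>"
    unfolding lambda2_def
    using eig \<open>\<nu> \<noteq> 0\<close> poincare_eigenvalue[OF conn D(2) f(3)]
    by (intro Least_equality) (auto simp: \<nu>_def)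
  moreover have "poincare ?A ?D c" if "c \<le> \<nu>"
    unfolding poincare_def
  proof (intro allI impI)
    fix g :: "'a \<Rightarrow> real" assume "sum g ?D = 0"
    then have "\<nu> * (\<Sum>v\<in>?D. (g v)\<^sup>2) \<le> energy ?A g"
      using poincareD[OF f(3)] unfolding \<nu>_def by blast
    moreover have "c * (\<Sum>v\<in>?D. (g v)\<^sup>2) \<le> \<nu> * (\<Sum>v\<in>?D. (g v)\<^sup>2)"
      using that by (intro mult_right_mono) (auto intro: sum_nonneg)
    ultimately show "c * (\<Sum>v\<in>?D. (g v)\<^sup>2) \<le> energy ?A g" by linarith
  qed
  moreover have "c \<le> \<nu>" if "poincare ?A ?D c"
    using poincare_eigenvalue[OF conn D(2) that eig \<open>\<nu> \<noteq> 0\<close>] .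
  ultimately show ?thesis by blast
qed

section \<open>Trees with a distinguished path\<close>

definition delete_edge :: "('a \<times> 'a) set \<Rightarrow> 'a \<Rightarrow> 'a \<Rightarrow> ('a \<times> 'a) set" where
  "delete_edge A u v = A - {(u, v), (v, u)}"

lemma sym_delete_edge: "sym A \<Longrightarrow> sym (delete_edge A u v)"
  by (auto simp: delete_edge_def sym_def)

text \<open>Absence of cycles is encoded by \<open>bridge\<close>. This turns arguments about cycles
  into arguments about reachability in sub-relations.\<close>

locale relational_tree =
  fixes V :: "'a set" and A :: "('a \<times> 'a) set"
  assumes finite_V: "finite V"
    and A_subset: "A \<subseteq> V \<times> V"
    and sym_A: "sym A"
    and irrefl_A: "(u, u) \<notin> A"
    and connected_A: "u \<in> V \<Longrightarrow> v \<in> V \<Longrightarrow> (u, v) \<in> A\<^sup>*"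
    and bridge: "(u, v) \<in> A \<Longrightarrow> (u, v) \<notin> (delete_edge A u v)\<^sup>*"
begin

definition leaves :: "'a set" where
  "leaves = {v \<in> V. card (A `` {v}) = 1}"

lemma finite_A: "finite A"
  using A_subset finite_V finite_subset by blast

lemma finite_leaves: "finite leaves"
  using finite_V by (simp add: leaves_def)

lemma bridge_converse: "(u, v) \<in> A \<Longrightarrow> (v, u) \<notin> (delete_edge A u v)\<^sup>*"
  using bridge sym_rtrancl[OF sym_delete_edge[OF sym_A]] by (meson symD)

lemma reach_in_V:
  assumes "(u, v) \<in> B\<^sup>*" "u \<in> V" "B \<subseteq> A"
  shows "v \<in> V"
  using assms A_subset by (induction rule: rtrancl_induct) auto

text \<open>Induction on the size of the branch behind the edge: if \<open>v\<close> is no leaf, it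
  has a further neighbour \<open>w\<close>, and the branch behind \<open>w\<close> is strictly
  smaller because it lacks \<open>v\<close>.\<close>

lemma branch_has_leaf:
  assumes "(u, v) \<in> A"
  shows "\<exists>w\<in>leaves. (v, w) \<in> (delete_edge A u v)\<^sup>*"
  using assms
proof (induction "card {w. (v, w) \<in> (delete_edge A u v)\<^sup>*}" arbitrary: u v rule: less_induct)
  case less
  have V: "u \<in> V" "v \<in> V" and "u \<noteq> v"
    using less.prems A_subset irrefl_A by auto
  have vu: "(v, u) \<in> A"
    using less.prems sym_A by (auto dest: symD)
  show ?case
  proof (cases "A `` {v} = {u}")
    case True
    then have "v \<in> leaves" using V by (simp add: leaves_def)
    then show ?thesis by blast
  next
    case False
    then obtain w where w: "(v, w) \<in> A" "w \<noteq> u" using vu by blast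
    have "v \<noteq> w" using w irrefl_A by auto
    \<comment> \<open>By the bridge property a walk in the branch behind \<open>w\<close> never
      meets \<open>v\<close>, so it cannot use the edge between \<open>u\<close> and
      \<open>v\<close>.\<close>
    have sub: "(v, z) \<in> (delete_edge A u v)\<^sup>* \<and> z \<noteq> v" if "(w, z) \<in> (delete_edge A v w)\<^sup>*" for z
      using that
    proof (induction rule: rtrancl_induct)
      case base
      then show ?case
        using w \<open>u \<noteq> v\<close> \<open>v \<noteq> w\<close> by (auto simp: delete_edge_def)
    next
      case (step y z)
      have "(w, z) \<in> (delete_edge A v w)\<^sup>*" using step by simp
      then have "z \<noteq> v" using bridge_converse[OF w(1)] by auto
      moreover have "(y, z) \<in> delete_edge A u v"
        using step \<open>z \<noteq> v\<close> by (auto simp: delete_edge_def)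
      ultimately show ?case using step by auto
    qed
    have "{z. (v, z) \<in> (delete_edge A u v)\<^sup>*} \<subseteq> V"
    proof
      fix z assume "z \<in> {z. (v, z) \<in> (delete_edge A u v)\<^sup>*}"
      then show "z \<in> V"
        using reach_in_V[of v z "delete_edge A u v"] V(2) by (auto simp: delete_edge_def)
    qed
    then have "finite {z. (v, z) \<in> (delete_edge A u v)\<^sup>*}"
      using finite_V finite_subset by blast
    moreover have "{z. (w, z) \<in> (delete_edge A v w)\<^sup>*} \<subset> {z. (v, z) \<in> (delete_edge A u v)\<^sup>*}"
      using sub by blast
    ultimately have "\<exists>z\<in>leaves. (w, z) \<in> (delete_edge A v w)\<^sup>*"
      using less.hyps[OF psubset_card_mono w(1)] by blast
    then show ?thesis using sub by blast
  qed
qed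

end

locale tree_with_path = relational_tree V A
  for V :: "'a set" and A +
  fixes L :: nat and x :: "nat \<Rightarrow> 'a"
  assumes L_pos: "L \<ge> 1"
    and path_edge: "j < L \<Longrightarrow> (x j, x (Suc j)) \<in> A"
    and inj_path: "inj_on x {0..L}"
begin

section \<open>The projection of the tree onto the path\<close>

definition path_edges :: "('a \<times> 'a) set" where
  "path_edges = (\<lambda>j. (x j, x (Suc j))) ` {..<L} \<union> (\<lambda>j. (x (Suc j), x j)) ` {..<L}"

definition off_path :: "('a \<times> 'a) set" where
  "off_path = A - path_edges"

text \<open>All path edges are removed at once, so that these sets partition \<open>V\<close>. The
  components of the theorem lose only the two edges at \<open>x k\<close>;
  \<open>component_eq_hanging\<close> shows that they are the same sets for inner
  \<open>k\<close>.\<close>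

definition hanging :: "nat \<Rightarrow> 'a set" where
  "hanging k = {v. (x k, v) \<in> off_path\<^sup>*}"

lemma x_eq_iff: "i \<le> L \<Longrightarrow> j \<le> L \<Longrightarrow> x i = x j \<longleftrightarrow> i = j"
  using inj_path by (auto simp: inj_on_def)

lemma path_edge': "j < L \<Longrightarrow> (x (Suc j), x j) \<in> A"
  using path_edge sym_A by (meson symD)

lemma x_in_V: "j \<le> L \<Longrightarrow> x j \<in> V"
  using path_edge[of j] path_edge[of "j - 1"] A_subset L_pos
  by (cases "j < L") auto

lemma path_edges_subset: "path_edges \<subseteq> A"
  using path_edge path_edge' by (auto simp: path_edges_def)

lemma path_edge_ends:
  assumes "(u, v) \<in> path_edges"
  obtains i j where "i \<le> L" "j \<le> L" "u = x i" "v = x j"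
proof -
  obtain k where "k < L" "u = x k \<and> v = x (Suc k) \<or> u = x (Suc k) \<and> v = x k"
    using assms by (auto simp: path_edges_def)
  then show thesis
    using that[of k "Suc k"] that[of "Suc k" k] by auto
qed

lemma sym_path_edges: "sym path_edges"
  by (auto simp: path_edges_def sym_def)

lemma sym_off_path: "sym off_path"
  using sym_A sym_path_edges by (auto simp: off_path_def sym_def)

lemma off_path_rtrancl_sym: "(u, v) \<in> off_path\<^sup>* \<Longrightarrow> (v, u) \<in> off_path\<^sup>*"
  using sym_rtrancl[OF sym_off_path] by (meson symD)

lemma path_reach:
  assumes "a \<le> b" "\<And>m. a \<le> m \<Longrightarrow> m < b \<Longrightarrow> (x m, x (Suc m)) \<in> B"
  shows "(x a, x b) \<in> B\<^sup>*"
  using assms by (induction b rule: dec_induct) (auto intro: rtrancl_into_rtrancl)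

text \<open>A connection off the path, followed by the path from \<open>x j\<close> back to
  \<open>x (Suc i)\<close>, would bypass the bridge between \<open>x i\<close> and
  \<open>x (Suc i)\<close>.\<close>

lemma not_off_path_reach:
  assumes "i < j" "j \<le> L"
  shows "(x i, x j) \<notin> off_path\<^sup>*"
proof
  let ?C = "delete_edge A (x i) (x (Suc i))"
  assume "(x i, x j) \<in> off_path\<^sup>*"
  moreover have "off_path \<subseteq> ?C"
    using assms by (auto simp: off_path_def path_edges_def delete_edge_def)
  ultimately have "(x i, x j) \<in> ?C\<^sup>*"
    using rtrancl_mono by blast
  moreover have "(x (Suc i), x j) \<in> ?C\<^sup>*"
    using assms by (intro path_reach) (auto simp: delete_edge_def path_edge x_eq_iff)
  then have "(x j, x (Suc i)) \<in> ?C\<^sup>*"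
    using sym_rtrancl[OF sym_delete_edge[OF sym_A]] by (meson symD)
  ultimately have "(x i, x (Suc i)) \<in> ?C\<^sup>*"
    by (rule rtrancl_trans)
  then show False
    using bridge path_edge assms by simp
qed

lemma off_path_reach_unique:
  assumes "(x i, v) \<in> off_path\<^sup>*" "(x j, v) \<in> off_path\<^sup>*" "i \<le> L" "j \<le> L"
  shows "i = j"
proof -
  have "(x i, x j) \<in> off_path\<^sup>*" "(x j, x i) \<in> off_path\<^sup>*"
    using assms off_path_rtrancl_sym rtrancl_trans by metis+
  then show ?thesis
    using not_off_path_reach assms by (metis linorder_neqE_nat)
qed

lemma off_path_cover:
  assumes "v \<in> V"
  shows "\<exists>j\<le>L. (x j, v) \<in> off_path\<^sup>*"
proof -
  have "(x 0, v) \<in> A\<^sup>*"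
    using connected_A x_in_V assms by simp
  then show ?thesis
  proof (induction rule: rtrancl_induct)
    case base
    then show ?case by blast
  next
    case (step y z)
    show ?case
    proof (cases "(y, z) \<in> off_path")
      case True
      then show ?thesis using step by (meson rtrancl_into_rtrancl)
    next
      case False
      then have "(y, z) \<in> path_edges" using step by (simp add: off_path_def)
      then obtain j where "j \<le> L" "z = x j"
        by (rule path_edge_ends)
      then show ?thesis by blast
    qed
  qed
qed

text \<open>Read as a real function, this is the trial function for the upper bound: constant on
  each \<open>hanging k\<close>, and climbing by one along each path edge.\<close>

definition idx :: "'a \<Rightarrow> nat" where
  "idx v = (THE j. j \<le> L \<and> (x j, v) \<in> off_path\<^sup>*)"

lemma idx_eq: "j \<le> L \<Longrightarrow> v \<in> hanging j \<Longrightarrow> idx v = j"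
  unfolding idx_def hanging_def using off_path_reach_unique by (intro the_equality) auto

lemma idx_x: "j \<le> L \<Longrightarrow> idx (x j) = j"
  by (rule idx_eq) (auto simp: hanging_def)

lemma idx_props:
  assumes "v \<in> V"
  shows "idx v \<le> L" "v \<in> hanging (idx v)"
  using off_path_cover[OF assms] idx_eq by (auto simp: hanging_def)

lemma hanging_subset: "j \<le> L \<Longrightarrow> hanging j \<subseteq> V"
  using reach_in_V[of "x j" _ off_path] x_in_V by (auto simp: hanging_def off_path_def)

lemma hanging_iff: "j \<le> L \<Longrightarrow> v \<in> hanging j \<longleftrightarrow> v \<in> V \<and> idx v = j"
  using idx_eq hanging_subset idx_props by blast

lemma off_path_hanging: "(u, v) \<in> off_path \<Longrightarrow> u \<in> hanging k \<Longrightarrow> v \<in> hanging k"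
  by (auto simp: hanging_def intro: rtrancl_into_rtrancl)

lemma idx_off_path:
  assumes "(u, v) \<in> off_path"
  shows "idx u = idx v"
proof -
  have "u \<in> V" using assms A_subset by (auto simp: off_path_def)
  then show ?thesis
    using idx_props[of u] idx_eq off_path_hanging[OF assms] by metis
qed

lemma sum_path_edges:
  fixes f :: "'a \<Rightarrow> real"
  shows "(\<Sum>(u, v)\<in>path_edges. (f u - f v)\<^sup>2) = 2 * (\<Sum>j<L. (f (x (Suc j)) - f (x j))\<^sup>2)"
proof -
  have inj: "inj_on (\<lambda>j. (x j, x (Suc j))) {..<L}" "inj_on (\<lambda>j. (x (Suc j), x j)) {..<L}"
    by (auto simp: inj_on_def x_eq_iff)
  have disj: "(\<lambda>j. (x j, x (Suc j))) ` {..<L} \<inter> (\<lambda>j. (x (Suc j), x j)) ` {..<L} = {}"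
    by (auto simp: x_eq_iff)
  have "(\<Sum>j<L. (f (x j) - f (x (Suc j)))\<^sup>2) = (\<Sum>j<L. (f (x (Suc j)) - f (x j))\<^sup>2)"
    by (intro sum.cong refl power2_commute)
  then show ?thesis
    unfolding path_edges_def
    by (simp add: sum.union_disjoint[OF _ _ disj] sum.reindex[OF inj(1)] sum.reindex[OF inj(2)])
qed

lemma energy_split:
  "energy A f = (\<Sum>j<L. (f (x (Suc j)) - f (x j))\<^sup>2) + energy off_path f"
proof -
  have "(\<Sum>(u, v)\<in>A. (f u - f v)\<^sup>2)
      = (\<Sum>(u, v)\<in>off_path. (f u - f v)\<^sup>2) + (\<Sum>(u, v)\<in>path_edges. (f u - f v)\<^sup>2)"
    unfolding off_path_def by (rule sum.subset_diff[OF path_edges_subset finite_A])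
  then show ?thesis
    by (simp add: energy_def sum_path_edges)
qed

lemma energy_idx: "energy A (\<lambda>v. real (idx v)) = real L"
proof -
  have "energy off_path (\<lambda>v. real (idx v)) = 0"
    using idx_off_path unfolding energy_def by (auto intro!: sum.neutral)
  then show ?thesis
    by (simp add: energy_split idx_x)
qed

text \<open>Telescoping and Cauchy-Schwarz; \<open>b - a\<close> is the effective resistance of the
  segment.\<close>

lemma path_increment_bound:
  assumes "a \<le> b"
  shows "(f (x b) - f (x a))\<^sup>2 \<le> real (b - a) * (\<Sum>j=a..<b. (f (x (Suc j)) - f (x j) :: real)\<^sup>2)"
proof -
  have "f (x b) - f (x a) = (\<Sum>j=a..<b. f (x (Suc j)) - f (x j))"
    using sum_Suc_diff'[OF assms, of "\<lambda>j. f (x j)"] by simp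
  also have "(\<dots>)\<^sup>2 \<le> (\<Sum>j=a..<b. (f (x (Suc j)) - f (x j))\<^sup>2) * (\<Sum>j=a..<b. 1\<^sup>2)"
    using Cauchy_Schwarz_ineq_sum[of "\<lambda>j. f (x (Suc j)) - f (x j)" "\<lambda>_. 1" "{a..<b}"] by simp
  finally show ?thesis by (simp add: mult.commute)
qed

text \<open>Any other neighbour \<open>w\<close> of \<open>x 0\<close> would start a branch that can be given the height \<open>-1\<close>.\<close>

lemma start_is_leaf:
  assumes lip: "\<And>h :: 'a \<Rightarrow> real. (\<And>u v. (u, v) \<in> A \<Longrightarrow> \<bar>h u - h v\<bar> \<le> 1) \<Longrightarrow>
      (\<And>u v. u \<in> V \<Longrightarrow> v \<in> V \<Longrightarrow> h v - h u \<le> real L)"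
  shows "x 0 \<in> leaves"
proof -
  have "w = x 1" if w: "(x 0, w) \<in> A" for w
  proof (rule ccontr)
    assume "w \<noteq> x 1"
    define B where "B = {z. (w, z) \<in> (delete_edge A (x 0) w)\<^sup>*}"
    define h :: "'a \<Rightarrow> real" where "h v = (if v \<in> B then -1 else real (idx v))" for v
    have wV: "w \<in> V" using w A_subset by auto
    have x0: "x 0 \<notin> B"
      using bridge_converse[OF w] by (simp add: B_def)
    have "(x 0, x L) \<in> (delete_edge A (x 0) w)\<^sup>*"
      by (rule path_reach)
         (use \<open>w \<noteq> x 1\<close> L_pos in \<open>auto simp: delete_edge_def path_edge x_eq_iff\<close>)
    then have xL: "x L \<notin> B"
      unfolding B_def using bridge_converse[OF w] sym_rtrancl[OF sym_delete_edge[OF sym_A]]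
      by (auto dest: symD rtrancl_trans)
    \<comment> \<open>Edges leave \<open>B\<close> only towards \<open>x 0\<close>, from height -1
      to height 0, so lowering the branch keeps \<open>h\<close> 1-Lipschitz.\<close>
    have B_closed: "v \<in> B" if "u \<in> B" "(u, v) \<in> A" "v \<noteq> x 0" for u v
    proof -
      have "(u, v) \<in> delete_edge A (x 0) w" using that x0 by (auto simp: delete_edge_def)
      then show ?thesis using that(1) by (auto simp: B_def intro: rtrancl_into_rtrancl)
    qed
    have half: "h v - h u \<le> 1" if uv: "(u, v) \<in> A" for u v
    proof (cases "u \<in> B \<longleftrightarrow> v \<in> B")
      case True
      have "real (idx v) - real (idx u) \<le> 1"
      proof (cases "(u, v) \<in> off_path")
        case True
        then show ?thesis using idx_off_path by simp
      next
        case False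
        then have "(u, v) \<in> path_edges" using uv by (simp add: off_path_def)
        then show ?thesis by (auto simp: path_edges_def idx_x)
      qed
      then show ?thesis using True by (simp add: h_def)
    next
      case False
      then consider "u \<in> B" "v \<notin> B" | "u \<notin> B" "v \<in> B" by blast
      then show ?thesis
      proof cases
        case 1
        then have "v = x 0" using B_closed uv by blast
        then show ?thesis using 1 by (simp add: h_def idx_x)
      next
        case 2
        then show ?thesis by (simp add: h_def)
      qed
    qed
    have "\<bar>h u - h v\<bar> \<le> 1" if "(u, v) \<in> A" for u v
      using half[OF that] half[of v u] that sym_A by (auto simp: abs_le_iff dest: symD)
    then have "h (x L) - h w \<le> real L"
      using lip[of h w "x L"] wV x_in_V by blast
    \<comment> \<open>From \<open>w\<close> to \<open>x L\<close> the function rises by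
      \<open>L + 1\<close>, more than \<open>lip\<close> allows.\<close>
    moreover have "h (x L) = real L" "h w = -1"
      using xL by (auto simp: h_def idx_x B_def)
    ultimately show False by simp
  qed
  moreover have "(x 0, x 1) \<in> A"
    using path_edge[of 0] L_pos by simp
  ultimately have "A `` {x 0} = {x 1}"
    by blast
  then show ?thesis
    using x_in_V by (simp add: leaves_def)
qed

lemma reversed_path: "tree_with_path V A L (\<lambda>j. x (L - j))"
proof
  show "(x (L - j), x (L - Suc j)) \<in> A" if "j < L" for j
    using path_edge'[of "L - Suc j"] that by (simp add: Suc_diff_Suc)
  show "inj_on (\<lambda>j. x (L - j)) {0..L}"
    by (auto simp: inj_on_def x_eq_iff)
qed (use L_pos in simp)

lemma endpoints_are_leaves:
  assumes lip: "\<And>h :: 'a \<Rightarrow> real. (\<And>u v. (u, v) \<in> A \<Longrightarrow> \<bar>h u - h v\<bar> \<le> 1) \<Longrightarrow>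
      (\<And>u v. u \<in> V \<Longrightarrow> v \<in> V \<Longrightarrow> h v - h u \<le> real L)"
  shows "x 0 \<in> leaves" "x L \<in> leaves"
proof -
  show "x 0 \<in> leaves"
    using lip by (rule start_is_leaf)
  interpret R: tree_with_path V A L "\<lambda>j. x (L - j)"
    by (rule reversed_path)
  show "x L \<in> leaves"
    using R.start_is_leaf[OF lip] by simp
qed

lemma inner_not_leaf:
  assumes "0 < k" "k < L"
  shows "x k \<notin> leaves"
proof
  assume "x k \<in> leaves"
  then obtain w where "A `` {x k} = {w}"
    by (auto simp: leaves_def card_1_singleton_iff)
  moreover have "x (Suc k) \<in> A `` {x k}" "x (k - 1) \<in> A `` {x k}"
    using path_edge[of k] path_edge'[of "k - 1"] assms by auto
  ultimately have "x (Suc k) = x (k - 1)" by auto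
  then show False using assms by (simp add: x_eq_iff)
qed

text \<open>The first edge leaving \<open>x k\<close> off the path opens a branch that contains a
  leaf; the branch cannot return to the path, so the leaf stays in \<open>hanging k\<close>.\<close>

lemma hanging_has_leaf:
  assumes "k \<le> L" "hanging k \<noteq> {x k}"
  shows "\<exists>w\<in>leaves. w \<in> hanging k \<and> w \<noteq> x k"
proof -
  obtain y where "(x k, y) \<in> off_path\<^sup>*" "y \<noteq> x k"
    using assms(2) by (auto simp: hanging_def)
  then obtain v where v: "(x k, v) \<in> off_path"
    by (metis converse_rtranclE)
  then have vA: "(x k, v) \<in> A" by (simp add: off_path_def)
  from branch_has_leaf[OF this] obtain w
    where w: "w \<in> leaves" "(v, w) \<in> (delete_edge A (x k) v)\<^sup>*" by blast
  have "w \<in> hanging k \<and> w \<noteq> x k"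
    using w(2)
  proof (induction rule: rtrancl_induct)
    case base
    then show ?case using v irrefl_A vA by (auto simp: hanging_def)
  next
    case (step y z)
    have "(v, z) \<in> (delete_edge A (x k) v)\<^sup>*" using step by simp
    then have "z \<noteq> x k" using bridge_converse[OF vA] by auto
    \<comment> \<open>An end of a path edge is some \<open>x j\<close>; lying in
      \<open>hanging k\<close>, it would be \<open>x k\<close> itself, which the walk
      avoids.\<close>
    moreover have "(y, z) \<in> off_path"
    proof (rule ccontr)
      assume "\<not> ?thesis"
      then have "(y, z) \<in> path_edges" using step by (auto simp: off_path_def delete_edge_def)
      then obtain j where "j \<le> L" "y = x j" by (rule path_edge_ends)
      then show False using step idx_eq[OF assms(1)] idx_x by metis
    qed
    ultimately show ?case using step off_path_hanging by blast
  qed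
  then show ?thesis using w(1) by blast
qed

lemma hanging_neighbours:
  assumes "k \<le> L" "v \<in> hanging k" "v \<noteq> x k" "(v, w) \<in> A"
  shows "(v, w) \<in> off_path" "w \<in> hanging k"
proof -
  show 1: "(v, w) \<in> off_path"
  proof (rule ccontr)
    assume "\<not> ?thesis"
    then have "(v, w) \<in> path_edges" using assms by (auto simp: off_path_def)
    then obtain j where "j \<le> L" "v = x j" by (rule path_edge_ends)
    then show False using assms idx_eq[OF assms(1)] idx_x by metis
  qed
  show "w \<in> hanging k" using off_path_hanging[OF 1] assms by blast
qed

text \<open>Away from \<open>x k\<close> the path stays usable. If a vertex projecting to another
  \<open>x j\<close> were reachable, one could go from \<open>x k\<close> to \<open>x j\<close> and
  along the path to a neighbour of \<open>x k\<close>, around a deleted bridge.\<close>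

lemma component_eq_hanging:
  assumes "0 < k" "k < L"
  shows "{v. (x k, v) \<in> (delete_edge A (x (k - 1)) (x k) \<inter> delete_edge A (x k) (x (Suc k)))\<^sup>*} = hanging k"
proof (intro set_eqI iffI)
  let ?C = "delete_edge A (x (k - 1)) (x k) \<inter> delete_edge A (x k) (x (Suc k))"
  have off: "off_path \<subseteq> ?C"
  proof -
    have "(x (k - 1), x k) \<in> path_edges" "(x k, x (Suc k)) \<in> path_edges"
      using assms unfolding path_edges_def by (auto intro!: rev_image_eqI[of "k - 1"])
    then show ?thesis
      using sym_path_edges by (auto simp: off_path_def delete_edge_def dest: symD)
  qed
  have sym: "sym ?C"
    using sym_delete_edge[OF sym_A] by (simp add: sym_Int)
  fix v
  show "v \<in> {v. (x k, v) \<in> ?C\<^sup>*}" if "v \<in> hanging k"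
    using that rtrancl_mono[OF off] by (auto simp: hanging_def)
  show "v \<in> hanging k" if "v \<in> {v. (x k, v) \<in> ?C\<^sup>*}"
  proof -
    have kv: "(x k, v) \<in> ?C\<^sup>*" using that by simp
    then have "v \<in> V"
      using reach_in_V[of "x k" v ?C] x_in_V[of k] assms by (auto simp: delete_edge_def)
    define j where "j = idx v"
    have j: "j \<le> L" "(x j, v) \<in> ?C\<^sup>*" and v: "v \<in> hanging j"
      using idx_props[OF \<open>v \<in> V\<close>] rtrancl_mono[OF off] by (auto simp: j_def hanging_def)
    then have kj: "(x k, x j) \<in> ?C\<^sup>*" "(x j, x k) \<in> ?C\<^sup>*"
      using kv sym_rtrancl[OF sym] by (meson symD rtrancl_trans)+
    have "j = k"
    proof (rule ccontr)
      assume "j \<noteq> k"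
      then consider "j < k" | "k < j" by linarith
      then show False
      proof cases
        case 1
        have "(x j, x (k - 1)) \<in> ?C\<^sup>*"
          using 1 assms by (intro path_reach) (auto simp: delete_edge_def path_edge x_eq_iff)
        then have "(x k, x (k - 1)) \<in> ?C\<^sup>*"
          using kj by simp
        then have "(x k, x (k - 1)) \<in> (delete_edge A (x (k - 1)) (x k))\<^sup>*"
          using rtrancl_mono[of ?C "delete_edge A (x (k - 1)) (x k)"] by auto
        then show False
          using bridge_converse path_edge[of "k - 1"] assms by simp
      next
        case 2
        have "(x (Suc k), x j) \<in> ?C\<^sup>*"
          using 2 j assms by (intro path_reach) (auto simp: delete_edge_def path_edge x_eq_iff)
        then have "(x j, x (Suc k)) \<in> ?C\<^sup>*"
          using sym_rtrancl[OF sym] by (meson symD)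
        then have "(x k, x (Suc k)) \<in> ?C\<^sup>*"
          using kj by simp
        then have "(x k, x (Suc k)) \<in> (delete_edge A (x k) (x (Suc k)))\<^sup>*"
          using rtrancl_mono[of ?C "delete_edge A (x k) (x (Suc k))"] by auto
        then show False
          using bridge path_edge[of k] assms by simp
      qed
    qed
    then show ?thesis using v by simp
  qed
qed

end

section \<open>Poincare inequalities on trees\<close>

text \<open>The best such \<open>c\<close> is the first eigenvalue of the mixed problem: Steklov
  condition on \<open>D\<close>, Dirichlet condition at \<open>a\<close>.\<close>

definition dirichlet :: "('a \<times> 'a) set \<Rightarrow> 'a set \<Rightarrow> 'a \<Rightarrow> real \<Rightarrow> bool" where
  "dirichlet A D a c \<longleftrightarrow> (\<forall>g. g a = 0 \<longrightarrow> c * (\<Sum>v\<in>D. (g v)\<^sup>2) \<le> energy A g)"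

text \<open>The mean, here zero, is the best constant in least squares. This allows a function of
  zero sum to be shifted so as to vanish at a chosen vertex.\<close>

lemma sum_squares_shift:
  fixes f :: "'a \<Rightarrow> real"
  assumes "sum f D = 0"
  shows "(\<Sum>v\<in>D. (f v)\<^sup>2) \<le> (\<Sum>v\<in>D. (f v - k)\<^sup>2)"
proof -
  have "(\<Sum>v\<in>D. (f v - k)\<^sup>2) = (\<Sum>v\<in>D. (f v)\<^sup>2) - 2 * k * sum f D + real (card D) * k\<^sup>2"
    unfolding sum_distrib_left
    by (simp add: power2_diff sum.distrib sum_subtractf mult_ac)
  then show ?thesis using assms by simp
qed

locale tree_with_leaf_path = tree_with_path +
  assumes leaf_ends: "x 0 \<in> leaves" "x L \<in> leaves"
begin

lemma ends_distinct: "x 0 \<noteq> x L"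
  using L_pos by (simp add: x_eq_iff)

lemma card_leaves: "card leaves \<ge> 2"
proof -
  have "card {x 0, x L} \<le> card leaves"
    using leaf_ends finite_leaves by (intro card_mono) auto
  then show ?thesis using ends_distinct by simp
qed

lemma sum_leaves:
  "sum f leaves = f (x 0) + f (x L) + sum f (leaves - {x 0, x L} :: 'a set)" for f :: "'a \<Rightarrow> real"
proof -
  have "leaves = insert (x 0) (insert (x L) (leaves - {x 0, x L}))"
    using leaf_ends by auto
  then have "sum f leaves = sum f (insert (x 0) (insert (x L) (leaves - {x 0, x L})))"
    by simp
  also have "\<dots> = f (x 0) + f (x L) + sum f (leaves - {x 0, x L})"
    using finite_leaves ends_distinct by simp
  finally show ?thesis .
qed

section \<open>The upper bound for the constant and its equality case\<close>

lemma poincare_height: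
  assumes "poincare A leaves c"
  shows "\<exists>m :: real. c * (m\<^sup>2 + (real L - m)\<^sup>2 + (\<Sum>v\<in>leaves - {x 0, x L}. (real (idx v) - m)\<^sup>2)) \<le> real L"
proof -
  \<comment> \<open>The mean height of the leaves, so that the height minus \<open>m\<close> is
    admissible.\<close>
  define m where "m = (\<Sum>v\<in>leaves. real (idx v)) / real (card leaves)"
  have "(\<Sum>v\<in>leaves. real (idx v) - m) = 0"
    using card_leaves by (simp add: sum_subtractf m_def)
  from poincareD[OF assms this]
  have "c * (\<Sum>v\<in>leaves. (real (idx v) - m)\<^sup>2) \<le> real L"
    by (simp add: energy_shift energy_idx)
  then show ?thesis
    by (intro exI[of _ m]) (simp add: sum_leaves idx_x)
qed

text \<open>The height \<open>idx\<close> along the path as a trial function: its two extreme values contribute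
  at least \<open>L\<^sup>2 / 2\<close> to the variance.\<close>

lemma poincare_le:
  assumes "poincare A leaves c"
  shows "c \<le> 2 / real L"
proof (rule ccontr)
  assume c: "\<not> c \<le> 2 / real L"
  obtain m where m: "c * (m\<^sup>2 + (real L - m)\<^sup>2
      + (\<Sum>v\<in>leaves - {x 0, x L}. (real (idx v) - m)\<^sup>2)) \<le> real L"
    using poincare_height[OF assms] by blast
  define S where "S = (\<Sum>v\<in>leaves - {x 0, x L}. (real (idx v) - m)\<^sup>2)"
  have "S \<ge> 0" by (simp add: S_def sum_nonneg)
  moreover have "m\<^sup>2 + (real L - m)\<^sup>2 = (real L)\<^sup>2 / 2 + 2 * (m - real L / 2)\<^sup>2"
    by (simp add: power2_eq_square field_simps)
  ultimately have "(real L)\<^sup>2 / 2 \<le> m\<^sup>2 + (real L - m)\<^sup>2 + S" by simp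
  moreover have Lp: "real L > 0" using L_pos by simp
  have cpos: "c > 2 / real L" using c by simp
  then have "c > 0" using Lp by (smt (verit) divide_pos_pos)
  ultimately have "c * ((real L)\<^sup>2 / 2) \<le> real L"
    using m by (smt (verit) S_def mult_left_mono)
  moreover have "2 / real L * ((real L)\<^sup>2 / 2) < c * ((real L)\<^sup>2 / 2)"
    using cpos Lp by (intro mult_strict_right_mono) auto
  ultimately show False using Lp by (simp add: power2_eq_square)
qed

text \<open>With constant \<open>2 / L\<close> the two endpoints alone exhaust the bound. Every
  excess must vanish: the mean is \<open>L / 2\<close>, and each further leaf has exactly this
  height.\<close>

lemma poincare_extremal:
  assumes "poincare A leaves (2 / real L)" "v \<in> leaves" "v \<noteq> x 0" "v \<noteq> x L"
  shows "2 * idx v = L"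
proof -
  obtain m where m: "2 / real L * (m\<^sup>2 + (real L - m)\<^sup>2
      + (\<Sum>v\<in>leaves - {x 0, x L}. (real (idx v) - m)\<^sup>2)) \<le> real L"
    using poincare_height[OF assms(1)] by blast
  define S where "S = (\<Sum>v\<in>leaves - {x 0, x L}. (real (idx v) - m)\<^sup>2)"
  have Lp: "real L > 0" using L_pos by simp
  have "2 * (m\<^sup>2 + (real L - m)\<^sup>2 + S) \<le> (real L)\<^sup>2"
    using m Lp by (simp add: S_def field_simps power2_eq_square)
  moreover have "m\<^sup>2 + (real L - m)\<^sup>2 = (real L)\<^sup>2 / 2 + 2 * (m - real L / 2)\<^sup>2"
    by (simp add: power2_eq_square field_simps)
  moreover have "(real (idx v) - m)\<^sup>2 \<le> S"
    unfolding S_def using assms finite_leaves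
    by (intro member_le_sum[of v "leaves - {x 0, x L}" "\<lambda>v. (real (idx v) - m)\<^sup>2"]) auto
  \<comment> \<open>The squares are abstracted to variables, so that only linear arithmetic
    remains.\<close>
  moreover have "2 * q + t \<le> 0" if "2 * (p + S) \<le> l" "p = l / 2 + 2 * q" "t \<le> S" "0 \<le> q" for p q l t :: real
    using that by argo
  ultimately have "2 * (m - real L / 2)\<^sup>2 + (real (idx v) - m)\<^sup>2 \<le> 0"
    using zero_le_power2 by blast
  then have "(m - real L / 2)\<^sup>2 = 0" "(real (idx v) - m)\<^sup>2 = 0"
    using zero_le_power2[of "m - real L / 2"] zero_le_power2[of "real (idx v) - m"] by linarith+
  then have "2 * real (idx v) = real L" by simp
  then show ?thesis by linarith
qed

section \<open>Reduction to the middle component\<close>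

lemma hanging_ends: "hanging 0 = {x 0}" "hanging L = {x L}"
proof -
  have no_arc: "hanging k = {x k}" if "\<And>w. (x k, w) \<in> A \<Longrightarrow> (x k, w) \<in> path_edges" for k
  proof -
    have "w = x k" if "(x k, w) \<in> off_path\<^sup>*" for w
      using that \<open>\<And>w. (x k, w) \<in> A \<Longrightarrow> (x k, w) \<in> path_edges\<close>
      by (cases rule: converse_rtranclE) (auto simp: off_path_def)
    then show ?thesis by (auto simp: hanging_def)
  qed
  \<comment> \<open>A leaf has one neighbour; if a path edge leads to it, no edge off the path
    remains.\<close>
  have single: "(v, w') \<in> path_edges"
    if v: "v \<in> leaves" "(v, w) \<in> path_edges" "(v, w') \<in> A" for v w w'
  proof -
    obtain z where "A `` {v} = {z}"
      using v(1) by (auto simp: leaves_def card_1_singleton_iff)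
    moreover have "w \<in> A `` {v}" "w' \<in> A `` {v}"
      using v path_edges_subset by auto
    ultimately have "w = w'" by simp
    then show ?thesis using v(2) by simp
  qed
  have "(x 0, x 1) \<in> path_edges" "(x L, x (L - 1)) \<in> path_edges"
    using L_pos unfolding path_edges_def by (auto intro!: rev_image_eqI[of "L - 1"])
  then show "hanging 0 = {x 0}" "hanging L = {x L}"
    using no_arc single leaf_ends by blast+
qed

text \<open>A nontrivial hanging part carries a leaf, whereas \<open>x k\<close> has two path
  neighbours and is none. This translates vanishing counts into a condition on the shape of the
  tree.\<close>

lemma hanging_leafless_iff:
  assumes "0 < k" "k < L"
  shows "hanging k \<inter> leaves = {} \<longleftrightarrow> hanging k = {x k}"
  using hanging_has_leaf[of k] inner_not_leaf[OF assms] assms by auto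

lemma hanging_all_trivial:
  assumes "\<forall>k. 0 < k \<and> k < L \<and> k \<noteq> m \<longrightarrow> hanging k = {x k}" "k \<le> L" "k \<noteq> m"
  shows "hanging k = {x k}"
  using assms hanging_ends by (metis bot_nat_0.not_eq_extremum le_neq_implies_less)

lemma off_path_only:
  assumes "\<forall>k. 0 < k \<and> k < L \<and> k \<noteq> m \<longrightarrow> hanging k = {x k}" "(u, v) \<in> off_path"
  shows "u \<in> hanging m \<and> v \<in> hanging m"
proof -
  define k where "k = idx u"
  have "u \<in> V" "u \<noteq> v"
    using assms(2) A_subset irrefl_A by (auto simp: off_path_def)
  then have u: "u \<in> hanging k" and "k \<le> L"
    using idx_props by (auto simp: k_def)
  then have v: "v \<in> hanging k" using off_path_hanging assms(2) by blast
  have "k = m"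
    using hanging_all_trivial[OF assms(1) \<open>k \<le> L\<close>] u v \<open>u \<noteq> v\<close> by (metis singletonD)
  then show ?thesis using u v by simp
qed

lemma leaves_only:
  assumes "\<forall>k. 0 < k \<and> k < L \<and> k \<noteq> m \<longrightarrow> hanging k = {x k}" "v \<in> leaves" "v \<notin> hanging m"
  shows "v = x 0 \<or> v = x L"
proof -
  have v: "v \<in> V" using assms(2) by (simp add: leaves_def)
  define k where "k = idx v"
  have k: "v \<in> hanging k" "k \<le> L" "k \<noteq> m"
    using idx_props[OF v] assms(3) by (auto simp: k_def)
  then have "v = x k"
    using hanging_all_trivial[OF assms(1) k(2,3)] by blast
  moreover have "\<not> (0 < k \<and> k < L)"
    using inner_not_leaf assms(2) \<open>v = x k\<close> by blast
  ultimately show ?thesis using k(2) by (cases "k = 0") auto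
qed

lemma poincare_iff_dirichlet:
  assumes L: "L = 2 * m"
    and triv: "\<forall>k. 0 < k \<and> k < L \<and> k \<noteq> m \<longrightarrow> hanging k = {x k}"
  shows "poincare A leaves (2 / real L) \<longleftrightarrow>
    dirichlet off_path (leaves \<inter> hanging m) (x m) (2 / real L)"
proof
  have m: "0 < m" "m < L" using L L_pos by auto
  have ends: "x 0 \<notin> hanging m" "x L \<notin> hanging m"
    using hanging_iff[of m] idx_x m by auto
  have rest: "leaves - {x 0, x L} = leaves \<inter> hanging m"
    using leaves_only[OF triv] ends by auto
  have c: "2 / real L = 1 / real m" using L by simp
  have split: "(\<Sum>j<L. h j) = (\<Sum>j=0..<m. h j) + (\<Sum>j=m..<L. h j)" for h :: "nat \<Rightarrow> real"
    using m by (simp add: lessThan_atLeast0 sum.atLeastLessThan_concat)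
  show "poincare A leaves (2 / real L)"
    if dir: "dirichlet off_path (leaves \<inter> hanging m) (x m) (2 / real L)"
    unfolding poincare_def
  proof (intro allI impI)
    fix f :: "'a \<Rightarrow> real" assume f: "sum f leaves = 0"
    define g where "g v = f v - f (x m)" for v
    have gm: "g (x m) = 0" by (simp add: g_def)
    \<comment> \<open>Each half-path has \<open>m\<close> edges and \<open>g\<close> vanishes at its
      inner end.\<close>
    have "1 / real m * (g (x 0))\<^sup>2 \<le> (\<Sum>j=0..<m. (g (x (Suc j)) - g (x j))\<^sup>2)"
      using path_increment_bound[of 0 m g] m gm by (simp add: field_simps)
    moreover have "1 / real m * (g (x L))\<^sup>2 \<le> (\<Sum>j=m..<L. (g (x (Suc j)) - g (x j))\<^sup>2)"
      using path_increment_bound[of m L g] m gm L by (simp add: field_simps)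
    moreover have "1 / real m * (\<Sum>v\<in>leaves \<inter> hanging m. (g v)\<^sup>2) \<le> energy off_path g"
      using dir gm unfolding dirichlet_def c by blast
    ultimately have "1 / real m * (\<Sum>v\<in>leaves. (g v)\<^sup>2) \<le> energy A g"
      unfolding sum_leaves energy_split split rest by (simp add: algebra_simps)
    moreover have "1 / real m * (\<Sum>v\<in>leaves. (f v)\<^sup>2) \<le> 1 / real m * (\<Sum>v\<in>leaves. (g v)\<^sup>2)"
      unfolding g_def by (intro mult_left_mono sum_squares_shift f) simp
    moreover have "energy A g = energy A f"
      unfolding g_def by (rule energy_shift)
    ultimately show "2 / real L * (\<Sum>v\<in>leaves. (f v)\<^sup>2) \<le> energy A f"
      unfolding c by linarith
  qed
  show "dirichlet off_path (leaves \<inter> hanging m) (x m) (2 / real L)"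
    if poin: "poincare A leaves (2 / real L)"
    unfolding dirichlet_def
  proof (intro allI impI)
    fix g :: "'a \<Rightarrow> real" assume g: "g (x m) = 0"
    define s where "s = (\<Sum>v\<in>leaves \<inter> hanging m. g v)"
    \<comment> \<open>Linear from 0 at \<open>x m\<close> to \<open>-s\<close> at
      \<open>x 0\<close>, which cancels the boundary sum of \<open>g\<close>; natural subtraction
      makes it zero on the other half.\<close>
    define f where "f v = (if v \<in> hanging m then g v else - s * real (m - idx v) / real m)" for v
    \<comment> \<open>At \<open>j = m\<close> both branches of \<open>f\<close> give 0, so one
      formula covers the whole path.\<close>
    have fx: "f (x j) = - s * real (m - j) / real m" if "j \<le> L" for j
      using that g hanging_iff[of m "x j"] m idx_x[OF that] by (auto simp: f_def)
    have fx0: "f (x 0) = - s" "f (x L) = 0"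
      using fx[of 0] fx[of L] m by auto
    have on: "f v = g v" if "v \<in> hanging m" for v
      using that by (simp add: f_def)
    have "sum f leaves = 0"
      unfolding sum_leaves rest by (simp add: fx0 on s_def)
    from poincareD[OF poin this]
    have "1 / real m * (s\<^sup>2 + (\<Sum>v\<in>leaves \<inter> hanging m. (g v)\<^sup>2)) \<le> energy A f"
      unfolding c sum_leaves rest by (simp add: fx0 on)
    moreover have "energy off_path f = energy off_path g"
      using off_path_only[OF triv] by (intro energy_cong) (auto simp: on)
    moreover have "(\<Sum>j<L. (f (x (Suc j)) - f (x j))\<^sup>2) = s\<^sup>2 / real m"
    proof -
      have "(\<Sum>j=0..<m. (f (x (Suc j)) - f (x j))\<^sup>2) = (\<Sum>j=0..<m. (s / real m)\<^sup>2)"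
      proof (intro sum.cong refl)
        fix j assume "j \<in> {0..<m}"
        then have "f (x (Suc j)) - f (x j) = s / real m"
          using m by (simp add: fx of_nat_diff field_simps)
        then show "(f (x (Suc j)) - f (x j))\<^sup>2 = (s / real m)\<^sup>2" by simp
      qed
      moreover have "(\<Sum>j=m..<L. (f (x (Suc j)) - f (x j))\<^sup>2) = 0"
        by (intro sum.neutral) (auto simp: fx)
      ultimately show ?thesis
        using m unfolding split by (simp add: power2_eq_square)
    qed
    ultimately show "2 / real L * (\<Sum>v\<in>leaves \<inter> hanging m. (g v)\<^sup>2) \<le> energy off_path g"
      unfolding c energy_split by (simp add: algebra_simps)
  qed
qed

text \<open>The two remaining leaves carry opposite values, so the squared difference between them
  is twice the sum of squares; Cauchy-Schwarz over \<open>L\<close> edges then gives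
  \<open>2 / L\<close>. This covers odd \<open>L\<close>, where the path has no middle
  vertex.\<close>

lemma poincare_path:
  assumes "\<forall>k. 0 < k \<and> k < L \<longrightarrow> hanging k = {x k}"
  shows "poincare A leaves (2 / real L)"
  unfolding poincare_def
proof (intro allI impI)
  fix f :: "'a \<Rightarrow> real" assume f: "sum f leaves = 0"
  have "leaves - {x 0, x L} = {}"
    using leaves_only[of 0] assms hanging_ends by auto
  then have sum: "sum h leaves = h (x 0) + h (x L)" for h :: "'a \<Rightarrow> real"
    by (subst sum_leaves) (simp only: sum.empty)
  have "f (x L) = - f (x 0)" using f sum by simp
  then have "(f (x L) - f (x 0))\<^sup>2 = 2 * (\<Sum>v\<in>leaves. (f v)\<^sup>2)"
    unfolding sum by (simp add: power2_eq_square algebra_simps)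
  moreover have "(f (x L) - f (x 0))\<^sup>2 \<le> real L * (\<Sum>j<L. (f (x (Suc j)) - f (x j))\<^sup>2)"
    using path_increment_bound[of 0 L f] by (simp add: lessThan_atLeast0)
  moreover have "(\<Sum>j<L. (f (x (Suc j)) - f (x j))\<^sup>2) \<le> energy A f"
    by (simp add: energy_split energy_nonneg)
  then have "real L * (\<Sum>j<L. (f (x (Suc j)) - f (x j))\<^sup>2) \<le> real L * energy A f"
    by (rule mult_left_mono) simp
  ultimately have "2 * (\<Sum>v\<in>leaves. (f v)\<^sup>2) \<le> real L * energy A f"
    by linarith
  then show "2 / real L * (\<Sum>v\<in>leaves. (f v)\<^sup>2) \<le> energy A f"
    using L_pos by (simp add: field_simps)
qed

lemma hanging_trivial_iff_path_covers:
  "(\<forall>k. 0 < k \<and> k < L \<longrightarrow> hanging k = {x k}) \<longleftrightarrow> V = x ` {0..L}"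
proof
  assume triv: "\<forall>k. 0 < k \<and> k < L \<longrightarrow> hanging k = {x k}"
  have "v \<in> x ` {0..L}" if "v \<in> V" for v
  proof -
    have "hanging (idx v) = {x (idx v)}"
      using triv hanging_ends idx_props(1)[OF that]
      by (metis bot_nat_0.not_eq_extremum le_neq_implies_less)
    then show ?thesis using idx_props[OF that] by auto
  qed
  then show "V = x ` {0..L}" using x_in_V by auto
next
  assume V: "V = x ` {0..L}"
  have "v = x k" if "k < L" "v \<in> hanging k" for k v
  proof -
    have "v \<in> V" "idx v = k" using that hanging_iff[of k v] by auto
    then show ?thesis using V idx_x by auto
  qed
  then show "\<forall>k. 0 < k \<and> k < L \<longrightarrow> hanging k = {x k}"
    by (auto simp: hanging_def)
qed

end

section \<open>The double of a graph\<close>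

lemma second_copy_inject [simp]: "second_copy a u = second_copy a v \<longleftrightarrow> u = v"
  by (auto simp: second_copy_def)

lemma Inl_eq_second_copy: "Inl u = second_copy a v \<longleftrightarrow> u = a \<and> v = a"
  by (auto simp: second_copy_def)

lemma second_copy_eq_Inl: "second_copy a v = Inl u \<longleftrightarrow> u = a \<and> v = a"
  by (auto simp: second_copy_def)

lemma arcs_ends_wedge_double:
  "arcs_ends (wedge_double H a) =
     map_prod Inl Inl ` arcs_ends H \<union> map_prod (second_copy a) (second_copy a) ` arcs_ends H"
proof -
  have "arc_to_ends (wedge_double H a) (Inl e) = map_prod Inl Inl (arc_to_ends H e)"
    "arc_to_ends (wedge_double H a) (Inr e) = map_prod (second_copy a) (second_copy a) (arc_to_ends H e)"
    for e by (simp_all add: arc_to_ends_def wedge_double_def)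
  then show ?thesis
    unfolding arcs_ends_def by (simp add: wedge_double_def image_Un image_image)
qed

lemma verts_wedge_double: "verts (wedge_double H a) = Inl ` verts H \<union> second_copy a ` verts H"
  by (simp add: wedge_double_def)

lemma rtrancl_map_prod:
  assumes "(u, v) \<in> R\<^sup>*"
  shows "(f u, f v) \<in> (map_prod f f ` R)\<^sup>*"
  using assms by (induction rule: rtrancl_induct) (auto intro: rtrancl_into_rtrancl)

context graph
begin

lemma irrefl_arcs_ends: "(u, u) \<notin> arcs_ends G"
  using adj_not_same by blast

text \<open>The copies share only the base vertex, so arcs of different copies with the same ends
  would be loops there; hence gluing creates no parallel arcs.\<close>

lemma graph_wedge_double: "graph (wedge_double G a)"
proof -
  let ?W = "wedge_double G a"
  have inj: "e = e'" if "e \<in> arcs G" "e' \<in> arcs G" "tail G e = tail G e'" "head G e = head G e'" for e e'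
    using that no_multi_arcs by (auto simp: arc_to_ends_def)
  have sym: "symmetric ?W"
    using sym_arcs_ends unfolding symmetric_def arcs_ends_wedge_double sym_def by auto
  show ?thesis
  proof unfold_locales
    show "symmetric ?W" by (rule sym)
    fix e assume e: "e \<in> arcs ?W"
    show "tail ?W e \<in> verts ?W" "head ?W e \<in> verts ?W"
      using e by (auto simp: wedge_double_def)
    show "tail ?W e \<noteq> head ?W e"
      using e no_loops by (auto simp: wedge_double_def)
  next
    fix e e' assume "e \<in> arcs ?W" "e' \<in> arcs ?W" "arc_to_ends ?W e = arc_to_ends ?W e'"
    then show "e = e'"
      by (auto simp: wedge_double_def arc_to_ends_def Inl_eq_second_copy second_copy_eq_Inl intro: inj)
         (metis no_loops)+
  qed (auto simp: wedge_double_def)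
qed

lemma connected_wedge_double:
  assumes conn: "\<And>u v. u \<in> verts G \<Longrightarrow> v \<in> verts G \<Longrightarrow> (u, v) \<in> (arcs_ends G)\<^sup>*"
    and a: "a \<in> verts G"
    and "p \<in> verts (wedge_double G a)" "q \<in> verts (wedge_double G a)"
  shows "(p, q) \<in> (arcs_ends (wedge_double G a))\<^sup>*"
proof -
  let ?A = "arcs_ends (wedge_double G a)"
  have copy: "second_copy a a = Inl a" by (simp add: second_copy_def)
  have l: "(Inl u, Inl v) \<in> ?A\<^sup>*" if "u \<in> verts G" "v \<in> verts G" for u v
    using rtrancl_map_prod[OF conn[OF that], of Inl] rtrancl_mono[of _ ?A]
    by (auto simp: arcs_ends_wedge_double)
  have r: "(second_copy a u, second_copy a v) \<in> ?A\<^sup>*" if "u \<in> verts G" "v \<in> verts G" for u v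
    using rtrancl_map_prod[OF conn[OF that], of "second_copy a"] rtrancl_mono[of _ ?A]
    by (auto simp: arcs_ends_wedge_double)
  have "(p, Inl a) \<in> ?A\<^sup>*"
    using assms(3) l[OF _ a] r[OF _ a] by (auto simp: verts_wedge_double copy)
  moreover have "(Inl a, q) \<in> ?A\<^sup>*"
    using assms(4) l[OF a] r[OF a] by (auto simp: verts_wedge_double copy)
  ultimately show ?thesis by (rule rtrancl_trans)
qed

lemma energy_wedge_double:
  "energy (arcs_ends (wedge_double G a)) F =
     energy (arcs_ends G) (\<lambda>v. F (Inl v)) + energy (arcs_ends G) (\<lambda>v. F (second_copy a v))"
proof -
  let ?A = "arcs_ends G"
  have inj: "inj_on (map_prod Inl Inl) ?A" "inj_on (map_prod (second_copy a) (second_copy a)) ?A"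
    by (auto simp: inj_on_def)
  have "map_prod Inl Inl ` ?A \<inter> map_prod (second_copy a) (second_copy a) ` ?A = {}"
    using irrefl_arcs_ends by (auto simp: Inl_eq_second_copy)
  then show ?thesis
    unfolding energy_def arcs_ends_wedge_double
    by (subst sum.union_disjoint)
       (simp_all add: finite_arcs_ends sum.reindex inj case_prod_unfold add_divide_distrib)
qed

text \<open>The base point is never a leaf of the double, since its degree there is even.\<close>

lemma boundary_wedge_double:
  assumes "a \<in> verts G"
  shows "boundary (wedge_double G a) = Inl ` (boundary G - {a}) \<union> Inr ` (boundary G - {a})"
proof -
  interpret W: graph "wedge_double G a" by (rule graph_wedge_double)
  let ?A = "arcs_ends G" and ?B = "arcs_ends (wedge_double G a)"
  have fin: "finite (?A `` {a})"
    by (rule finite_subset[OF _ finite_verts]) (auto dest: adj_in_verts)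
  have l: "?B `` {Inl v} = Inl ` (?A `` {v})" if "v \<noteq> a" for v
    using that by (auto simp: arcs_ends_wedge_double Inl_eq_second_copy)
  have r: "?B `` {Inr v} = second_copy a ` (?A `` {v})" if "v \<noteq> a" for v
  proof -
    have "Inr v = second_copy a v" using that by (simp add: second_copy_def)
    then show ?thesis
      using that by (auto simp: arcs_ends_wedge_double second_copy_eq_Inl simp del: sum.inject)
  qed
  have base: "?B `` {Inl a} = Inl ` (?A `` {a}) \<union> second_copy a ` (?A `` {a})"
  proof -
    have "(Inl a, second_copy a w) = map_prod (second_copy a) (second_copy a) (a, w)" for w
      by (simp add: second_copy_def)
    then show ?thesis
      unfolding arcs_ends_wedge_double
      by (auto simp: Inl_eq_second_copy simp del: map_prod_simp)
  qed
  \<comment> \<open>No neighbour of \<open>a\<close> is \<open>a\<close> itself, so its two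
    neighbourhoods stay disjoint and its degree doubles.\<close>
  have disj: "Inl ` (?A `` {a}) \<inter> second_copy a ` (?A `` {a}) = {}"
    using irrefl_arcs_ends by (auto simp: Inl_eq_second_copy)
  have card2: "card (second_copy a ` S) = card S" for S
    by (rule card_image) (simp add: inj_on_def)
  have "card (?B `` {Inl a}) = 2 * card (?A `` {a})"
    unfolding base using fin disj by (simp add: card_Un_disjoint card_image card2)
  then have a: "out_degree (wedge_double G a) (Inl a) \<noteq> 1"
    by (simp add: W.out_degree_eq_card)
  have deg: "out_degree (wedge_double G a) (Inl v) = out_degree G v"
    "out_degree (wedge_double G a) (Inr v) = out_degree G v" if "v \<noteq> a" for v
    unfolding W.out_degree_eq_card out_degree_eq_card l[OF that] r[OF that]
    by (simp_all add: card_image card2)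
  have "p \<in> boundary (wedge_double G a) \<longleftrightarrow>
      p \<in> Inl ` (boundary G - {a}) \<union> Inr ` (boundary G - {a})" for p
  proof (cases p)
    case (Inl v)
    then show ?thesis
      using a deg(1)[of v] assms
      by (cases "v = a") (auto simp: boundary_def verts_wedge_double Inl_eq_second_copy image_iff)
  next
    case (Inr v)
    then show ?thesis
      using deg(2)[of v]
      by (cases "v = a") (auto simp: boundary_def verts_wedge_double second_copy_def image_iff)
  qed
  then show ?thesis by blast
qed

text \<open>An antisymmetric extension has zero boundary sum by itself. Conversely, subtracting the
  value at the glued vertex makes the Dirichlet inequality applicable to each copy separately, and
  for nonnegative \<open>c\<close> the larger sum of squares only strengthens the result.\<close>

lemma lambda2_wedge_double_ge_iff:
  assumes conn: "\<And>u v. u \<in> verts G \<Longrightarrow> v \<in> verts G \<Longrightarrow> (u, v) \<in> (arcs_ends G)\<^sup>*"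
    and a: "a \<in> verts G"
    and ne: "boundary G - {a} \<noteq> {}"
    and c: "c \<ge> 0"
  shows "c \<le> lambda2 (wedge_double G a) \<longleftrightarrow> dirichlet (arcs_ends G) (boundary G - {a}) a c"
proof -
  interpret W: graph "wedge_double G a" by (rule graph_wedge_double)
  let ?A = "arcs_ends G" and ?B = "arcs_ends (wedge_double G a)"
  let ?D = "boundary G - {a}" and ?E = "boundary (wedge_double G a)"
  have fin: "finite ?D" by (simp add: boundary_def)
  have disj: "Inl ` ?D \<inter> Inr ` ?D = {}" by auto
  have "card ?D \<noteq> 0" using fin ne by simp
  have "card ?E = card ?D + card ?D"
    using fin disj by (simp add: boundary_wedge_double[OF a] card_Un_disjoint card_image)
  then have two: "card ?E \<ge> 2" using \<open>card ?D \<noteq> 0\<close> by simp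
  \<comment> \<open>The second sum uses \<open>second_copy\<close>, which is \<open>Inr\<close> off
    \<open>a\<close>, to match \<open>energy_wedge_double\<close>.\<close>
  have sumE: "sum F ?E = (\<Sum>v\<in>?D. F (Inl v)) + (\<Sum>v\<in>?D. F (second_copy a v))"
    for F :: "'a + 'a \<Rightarrow> real"
  proof -
    have "(\<Sum>v\<in>?D. F (second_copy a v)) = (\<Sum>v\<in>?D. F (Inr v))"
      by (intro sum.cong) (auto simp: second_copy_def)
    then show ?thesis
      using fin disj
      by (simp add: boundary_wedge_double[OF a] sum.union_disjoint sum.reindex)
  qed
  have "poincare ?B ?E c \<longleftrightarrow> dirichlet ?A ?D a c"
  proof
    assume poin: "poincare ?B ?E c"
    show "dirichlet ?A ?D a c"
      unfolding dirichlet_def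
    proof (intro allI impI)
      fix g :: "'a \<Rightarrow> real" assume g: "g a = 0"
      \<comment> \<open>At the glued vertex both prescriptions agree because
        \<open>g a = 0\<close>.\<close>
      define F where "F = case_sum g (\<lambda>v. - g v)"
      \<comment> \<open>The form \<open>-1 * g v\<close> lets \<open>energy_scale\<close>
        apply.\<close>
      have F: "F (Inl v) = g v" "F (second_copy a v) = -1 * g v" for v
        using g by (auto simp: F_def second_copy_def)
      have "sum F ?E = 0"
        unfolding sumE F by (simp add: sum_negf)
      from poincareD[OF poin this]
      have "c * ((\<Sum>v\<in>?D. (g v)\<^sup>2) + (\<Sum>v\<in>?D. (g v)\<^sup>2)) \<le> energy ?A g + energy ?A g"
        unfolding sumE energy_wedge_double F energy_scale by simp
      then show "c * (\<Sum>v\<in>?D. (g v)\<^sup>2) \<le> energy ?A g"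
        by (simp add: algebra_simps)
    qed
  next
    assume dir: "dirichlet ?A ?D a c"
    show "poincare ?B ?E c"
      unfolding poincare_def
    proof (intro allI impI)
      fix F :: "'a + 'a \<Rightarrow> real" assume F: "sum F ?E = 0"
      define k where "k = F (Inl a)"
      have "second_copy a a = Inl a" by (simp add: second_copy_def)
      then have "c * (\<Sum>v\<in>?D. (F (Inl v) - k)\<^sup>2) \<le> energy ?A (\<lambda>v. F (Inl v) - k)"
        "c * (\<Sum>v\<in>?D. (F (second_copy a v) - k)\<^sup>2) \<le> energy ?A (\<lambda>v. F (second_copy a v) - k)"
        using dir[unfolded dirichlet_def, rule_format, of "\<lambda>v. F (Inl v) - k"]
          dir[unfolded dirichlet_def, rule_format, of "\<lambda>v. F (second_copy a v) - k"]
        by (simp_all add: k_def)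
      then have "c * (\<Sum>p\<in>?E. (F p - k)\<^sup>2) \<le> energy ?B F"
        unfolding sumE energy_wedge_double by (simp add: energy_shift algebra_simps)
      moreover have "c * (\<Sum>p\<in>?E. (F p)\<^sup>2) \<le> c * (\<Sum>p\<in>?E. (F p - k)\<^sup>2)"
        using c by (intro mult_left_mono sum_squares_shift F)
      ultimately show "c * (\<Sum>p\<in>?E. (F p)\<^sup>2) \<le> energy ?B F"
        by linarith
    qed
  qed
  then show ?thesis
    using W.lambda2_ge_iff[OF connected_wedge_double[OF conn a] two] by blast
qed

end

section \<open>Finite trees and their Steklov eigenvalue\<close>

lemma finite_treeD:
  assumes "finite_tree G"
  shows "graph G" "u \<in> verts G \<Longrightarrow> v \<in> verts G \<Longrightarrow> (u, v) \<in> (arcs_ends G)\<^sup>*"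
proof -
  show "graph G" using assms by (simp add: finite_tree_def)
  interpret graph G by fact
  have "strongly_connected G"
    using assms sym_arcs by (intro symmetric_connected_imp_strongly_connected) (auto simp: finite_tree_def)
  then show "u \<in> verts G \<Longrightarrow> v \<in> verts G \<Longrightarrow> (u, v) \<in> (arcs_ends G)\<^sup>*"
    by (auto simp: strongly_connected_def intro!: reachable_rtranclI)
qed

text \<open>A walk from \<open>u\<close> to \<open>v\<close> avoiding the edge, shortened to a path
  and closed by the arc back to \<open>u\<close>, is a cycle. It has at least three arcs, since a
  path of one arc would be the deleted one.\<close>

lemma finite_tree_bridge:
  assumes "finite_tree G" and uv: "(u, v) \<in> arcs_ends G"
  shows "(u, v) \<notin> (delete_edge (arcs_ends G) u v)\<^sup>*"
proof
  interpret graph G using finite_treeD assms by blast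
  assume reach: "(u, v) \<in> (delete_edge (arcs_ends G) u v)\<^sup>*"
  define H where "H = G\<lparr>arcs := {e \<in> arcs G. arc_to_ends G e \<notin> {(u, v), (v, u)}}\<rparr>"
  interpret H: wf_digraph H
    by unfold_locales (auto simp: H_def)
  have ends: "arcs_ends H = delete_edge (arcs_ends G) u v"
    by (auto simp: H_def arcs_ends_def arc_to_ends_def delete_edge_def image_iff)
  have "u \<in> verts H" "u \<noteq> v"
    using uv adj_in_verts adj_not_same by (auto simp: H_def)
  then have "u \<rightarrow>\<^sup>*\<^bsub>H\<^esub> v"
    using reach by (simp add: H.reachable_conv' ends)
  then obtain p where p: "H.apath u p v"
    using H.reachable_apath by blast
  obtain e where e: "e \<in> arcs G" "tail G e = v" "head G e = u"
    using uv sym_arcs_ends by (meson reachableE symD)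
  have H_sel: "tail H = tail G" "head H = head G" "verts H = verts G"
    by (simp_all add: H_def)
  have H_arcs: "arcs H \<subseteq> arcs G" by (auto simp: H_def)
  have verts_eq: "H.awalk_verts w q = awalk_verts w q" for w q
    by (induction q arbitrary: w) (auto simp: H_sel)
  have cas_eq: "H.cas w q z = cas w q z" for w q z
    by (induction q arbitrary: w) (auto simp: H_sel)
  have walk: "awalk u p v" and dist: "distinct (awalk_verts u p)"
    using p H_arcs by (auto simp: H.apath_def H.awalk_def awalk_def verts_eq cas_eq H_sel)
  have "length p \<ge> 2"
  proof (rule ccontr)
    assume "\<not> ?thesis"
    then consider "p = []" | a where "p = [a]"
      by (cases p; cases "tl p") auto
    then show False
    proof cases
      case 1
      then show False using walk \<open>u \<noteq> v\<close> by (simp add: awalk_def)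
    next
      case 2
      then have "a \<in> arcs H" "arc_to_ends G a = (u, v)"
        using p walk by (auto simp: H.apath_def H.awalk_def awalk_def arc_to_ends_def)
      then show False by (simp add: H_def)
    qed
  qed
  have "awalk v [e] u"
    using e by (simp add: awalk_def adj_in_verts(1) flip: e(2))
  then have closed: "awalk u (p @ [e]) u"
    using walk by (rule awalk_appendI[rotated])
  have "awalk_verts u (p @ [e]) = awalk_verts u p @ [u]"
    using \<open>length p \<ge> 2\<close> e walk by (auto simp: awalk_verts_conv awalk_def cas_simp)
       (metis awalkE awalk_verts_conv last_snoc walk)
  then have "tl (awalk_verts u (p @ [e])) = tl (awalk_verts u p) @ [u]"
    by simp
  moreover have "awalk_verts u p = u # tl (awalk_verts u p)"
    using walk by (metis awalkE awalk_verts_non_Nil list.collapse)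
  then have "u \<notin> set (tl (awalk_verts u p))" "distinct (tl (awalk_verts u p))"
    using dist by (metis distinct.simps(2))+
  ultimately have "cycle (p @ [e])"
    unfolding cycle_def using closed by (intro exI[of _ u]) simp
  moreover have "length (p @ [e]) \<ge> 3" using \<open>length p \<ge> 2\<close> by simp
  ultimately show False
    using assms(1) unfolding finite_tree_def by blast
qed

lemma finite_tree_relational:
  assumes "finite_tree G"
  shows "relational_tree (verts G) (arcs_ends G)"
proof -
  interpret graph G using finite_treeD assms by blast
  show ?thesis
  proof
    show "arcs_ends G \<subseteq> verts G \<times> verts G" by (auto dest: adj_in_verts)
    show "sym (arcs_ends G)" by (rule sym_arcs_ends)
    show "(u, u) \<notin> arcs_ends G" for u by (rule irrefl_arcs_ends)
    show "(u, v) \<in> (arcs_ends G)\<^sup>*" if "u \<in> verts G" "v \<in> verts G" for u v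
      using finite_treeD(2)[OF assms that] .
    show "(u, v) \<notin> (delete_edge (arcs_ends G) u v)\<^sup>*" if "(u, v) \<in> arcs_ends G" for u v
      using finite_tree_bridge[OF assms that] .
  qed simp
qed

lemma (in wf_digraph) lipschitz_awalk:
  fixes h :: "'a \<Rightarrow> real"
  assumes "\<And>u v. (u, v) \<in> arcs_ends G \<Longrightarrow> \<bar>h u - h v\<bar> \<le> 1" "awalk u p v"
  shows "h v - h u \<le> awalk_cost (\<lambda>_. 1) p"
  using assms(2)
proof (induction p arbitrary: u)
  case Nil
  then show ?case by (simp add: awalk_Nil_iff)
next
  case (Cons e p)
  then have "h v - h (head G e) \<le> awalk_cost (\<lambda>_. 1) p" "tail G e = u" "e \<in> arcs G"
    by (auto simp: awalk_Cons_iff)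
  moreover from this have "\<bar>h u - h (head G e)\<bar> \<le> 1"
    by (intro assms(1)) (auto simp: arcs_ends_conv)
  ultimately show ?case by simp
qed

text \<open>A 1-Lipschitz function bounds distances from below, so the diameter bounds its
  oscillation. This supplies the assumption of \<open>endpoints_are_leaves\<close>.\<close>

lemma (in wf_digraph) lipschitz_le_diameter:
  fixes h :: "'a \<Rightarrow> real"
  assumes "graph_diameter G = ereal d"
    and "\<And>u v. (u, v) \<in> arcs_ends G \<Longrightarrow> \<bar>h u - h v\<bar> \<le> 1"
    and "u \<in> verts G" "v \<in> verts G"
  shows "h v - h u \<le> d"
proof -
  have "ereal (h v - h u) \<le> \<mu> (\<lambda>_. 1) u v"
    unfolding \<mu>_def using lipschitz_awalk[OF assms(2)] by (intro INF_greatest) simp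
  also have "\<dots> \<le> graph_diameter G"
    unfolding graph_diameter_def using assms(3,4) by (intro SUP_upper2[of u] SUP_upper2[of v]) auto
  finally show ?thesis using assms(1) by simp
qed

section \<open>The components of the digraph and their Steklov problem\<close>

locale steklov_tree = graph G + tree_with_leaf_path "verts G" "arcs_ends G" L x
  for G :: "('a, 'b) pre_digraph" and L x
begin

lemma boundary_eq_leaves: "boundary G = leaves"
  by (simp add: boundary_def leaves_def out_degree_eq_card)

text \<open>The height function always yields the upper bound \<open>2 / L\<close>, so equality
  amounts to the lower bound.\<close>

lemma lambda2_eq_iff: "lambda2 G = 2 / real L \<longleftrightarrow> poincare (arcs_ends G) leaves (2 / real L)"
proof -
  have ge: "c \<le> lambda2 G \<longleftrightarrow> poincare (arcs_ends G) leaves c" for c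
    using lambda2_ge_iff[OF connected_A] card_leaves by (simp add: boundary_eq_leaves)
  have "lambda2 G \<le> 2 / real L"
    using poincare_le ge by blast
  then show ?thesis using ge[of "2 / real L"] by auto
qed

lemma arcs_ends_remove_path_edges:
  "arcs_ends (remove_path_edges G x k) =
     delete_edge (arcs_ends G) (x (k - 1)) (x k) \<inter> delete_edge (arcs_ends G) (x k) (x (Suc k))"
  by (auto simp: remove_path_edges_def delete_edge_def arcs_ends_conv doubleton_eq_iff)

lemma verts_path_component:
  assumes "0 < k" "k < L"
  shows "verts (path_component G x k) = hanging k"
proof -
  interpret R: wf_digraph "remove_path_edges G x k"
    by unfold_locales (auto simp: remove_path_edges_def)
  have "x k \<in> verts (remove_path_edges G x k)"
    using x_in_V[of k] assms by (simp add: remove_path_edges_def)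
  then have "{v. reachable (remove_path_edges G x k) (x k) v} = hanging k"
    unfolding R.reachable_conv'[OF \<open>x k \<in> _\<close>] arcs_ends_remove_path_edges
    by (intro component_eq_hanging assms)
  then show ?thesis
    by (simp add: path_component_def Let_def)
qed

text \<open>Consecutive path vertices have different projections, so no path edge has both ends in
  \<open>hanging k\<close>.\<close>

lemma arcs_path_component:
  assumes "0 < k" "k < L"
  shows "arcs (path_component G x k) = {e \<in> arcs G. arc_to_ends G e \<in> off_path \<and> tail G e \<in> hanging k}"
proof -
  have "arcs (path_component G x k) = {e \<in> arcs (remove_path_edges G x k).
      tail G e \<in> verts (path_component G x k) \<and> head G e \<in> verts (path_component G x k)}"
    by (simp add: path_component_def Let_def induce_subgraph_def remove_path_edges_def)
  also have "\<dots> = {e \<in> arcs (remove_path_edges G x k). tail G e \<in> hanging k \<and> head G e \<in> hanging k}"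
    by (simp add: verts_path_component[OF assms])
  also have "\<dots> = {e \<in> arcs G. arc_to_ends G e \<in> off_path \<and> tail G e \<in> hanging k}"
  proof (intro set_eqI iffI)
    fix e assume "e \<in> {e \<in> arcs (remove_path_edges G x k). tail G e \<in> hanging k \<and> head G e \<in> hanging k}"
    then have e: "e \<in> arcs G" "tail G e \<in> hanging k" "head G e \<in> hanging k"
      by (auto simp: remove_path_edges_def)
    have "arc_to_ends G e \<notin> path_edges"
    proof
      assume "arc_to_ends G e \<in> path_edges"
      then have "\<exists>j<L. {tail G e, head G e} = {x j, x (Suc j)}"
        by (auto simp: path_edges_def arc_to_ends_def doubleton_eq_iff)
      then obtain j where "j < L" "{tail G e, head G e} = {x j, x (Suc j)}"
        by blast
      then have "x j \<in> hanging k" "x (Suc j) \<in> hanging k"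
        using e by (auto simp: doubleton_eq_iff)
      then show False
        using \<open>j < L\<close> idx_eq[of k "x j"] idx_eq[of k "x (Suc j)"] assms by (simp add: idx_x)
    qed
    moreover have "arc_to_ends G e \<in> arcs_ends G" using e by (simp add: arcs_ends_def)
    ultimately show "e \<in> {e \<in> arcs G. arc_to_ends G e \<in> off_path \<and> tail G e \<in> hanging k}"
      using e by (simp add: off_path_def)
  next
    fix e assume "e \<in> {e \<in> arcs G. arc_to_ends G e \<in> off_path \<and> tail G e \<in> hanging k}"
    then have e: "e \<in> arcs G" "(tail G e, head G e) \<in> off_path" "tail G e \<in> hanging k"
      by (auto simp: arc_to_ends_def)
    have not_path: "{tail G e, head G e} \<noteq> {x j, x (Suc j)}" if "j < L" for j
      using e(2) that by (auto simp: off_path_def path_edges_def doubleton_eq_iff)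
    have "e \<in> arcs (remove_path_edges G x k)"
      using e(1) not_path[of k] not_path[of "k - 1"] assms by (simp add: remove_path_edges_def)
    then show "e \<in> {e \<in> arcs (remove_path_edges G x k). tail G e \<in> hanging k \<and> head G e \<in> hanging k}"
      using e off_path_hanging by blast
  qed
  finally show ?thesis .
qed

lemma path_component_sel [simp]:
  "tail (path_component G x k) = tail G" "head (path_component G x k) = head G"
  by (simp_all add: path_component_def Let_def induce_subgraph_def remove_path_edges_def)

lemma arcs_ends_path_component:
  assumes "0 < k" "k < L"
  shows "arcs_ends (path_component G x k) = {(u, v) \<in> off_path. u \<in> hanging k}"
proof -
  have "\<exists>e\<in>arcs G. arc_to_ends G e = p" if "p \<in> off_path" for p
  proof -
    have "p \<in> arcs_ends G" using that by (simp add: off_path_def)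
    then show ?thesis by (auto simp: arcs_ends_def)
  qed
  moreover have "arcs_ends (path_component G x k) = arc_to_ends G ` arcs (path_component G x k)"
    by (simp add: arcs_ends_conv arc_to_ends_def[abs_def])
  ultimately show ?thesis
    unfolding arcs_path_component[OF assms] by (fastforce simp: arc_to_ends_def)
qed

lemma graph_path_component:
  assumes "0 < k" "k < L"
  shows "graph (path_component G x k)"
proof unfold_locales
  have sub: "arcs (path_component G x k) \<subseteq> arcs G"
    by (auto simp: arcs_path_component[OF assms])
  then show "finite (arcs (path_component G x k))"
    using finite_arcs finite_subset by blast
  show "finite (verts (path_component G x k))"
    using finite_subset[OF hanging_subset[of k] finite_V] assms
    by (simp add: verts_path_component[OF assms])
  show "symmetric (path_component G x k)"
    using sym_off_path off_path_hanging
    by (auto simp: symmetric_def sym_def arcs_ends_path_component[OF assms])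
  fix e assume e: "e \<in> arcs (path_component G x k)"
  then show "tail (path_component G x k) e \<in> verts (path_component G x k)"
    "head (path_component G x k) e \<in> verts (path_component G x k)"
    using off_path_hanging
    by (auto simp: arcs_path_component[OF assms] verts_path_component[OF assms] arc_to_ends_def)
  show "tail (path_component G x k) e \<noteq> head (path_component G x k) e"
    using e sub no_loops by auto
next
  fix e e' assume "e \<in> arcs (path_component G x k)" "e' \<in> arcs (path_component G x k)"
    "arc_to_ends (path_component G x k) e = arc_to_ends (path_component G x k) e'"
  then show "e = e'"
    by (intro no_multi_arcs) (auto simp: arcs_path_component[OF assms] arc_to_ends_def)
qed

lemma connected_path_component:
  assumes "0 < k" "k < L" "u \<in> hanging k" "v \<in> hanging k"
  shows "(u, v) \<in> (arcs_ends (path_component G x k))\<^sup>*"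
proof -
  let ?B = "{(u, v) \<in> off_path. u \<in> hanging k}"
  have to: "(x k, w) \<in> ?B\<^sup>*" if "w \<in> hanging k" for w
  proof -
    have "(x k, w) \<in> off_path\<^sup>*" using that by (simp add: hanging_def)
    then show ?thesis
    proof (induction rule: rtrancl_induct)
      case (step y z)
      then have "(y, z) \<in> ?B" by (simp add: hanging_def)
      with step show ?case by (meson rtrancl_into_rtrancl)
    qed simp
  qed
  have "sym ?B"
    using sym_off_path off_path_hanging by (auto simp: sym_def)
  then have "(u, x k) \<in> ?B\<^sup>*"
    using to[OF assms(3)] sym_rtrancl by (meson symD)
  then show ?thesis
    using to[OF assms(4)] by (auto simp: arcs_ends_path_component[OF assms(1,2)])
qed

text \<open>Vertices other than \<open>x k\<close> keep all their edges and hence their degree. At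
  \<open>x k\<close> two edges are lost: it may have degree one in the component, but it is no leaf
  of \<open>G\<close>.\<close>

lemma boundary_path_component:
  assumes "0 < k" "k < L"
  shows "boundary (path_component G x k) - {x k} = leaves \<inter> hanging k"
proof -
  interpret H: graph "path_component G x k" by (rule graph_path_component[OF assms])
  have "arcs_ends (path_component G x k) `` {v} = arcs_ends G `` {v}" if "v \<in> hanging k" "v \<noteq> x k" for v
    using hanging_neighbours[of k v] that assms
    by (auto simp: arcs_ends_path_component[OF assms] off_path_def)
  then have "v \<in> boundary (path_component G x k) \<longleftrightarrow> v \<in> leaves" if "v \<in> hanging k" "v \<noteq> x k" for v
    using that hanging_subset[of k] assms
    by (auto simp: boundary_def leaves_def H.out_degree_eq_card verts_path_component[OF assms])
  moreover have "boundary (path_component G x k) \<subseteq> hanging k"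
    by (auto simp: boundary_def verts_path_component[OF assms])
  ultimately show ?thesis
    using inner_not_leaf[OF assms] by blast
qed

lemma boundary_count_eq_0_iff:
  assumes "0 < k" "k < L"
  shows "boundary_count G x k = 0 \<longleftrightarrow> hanging k = {x k}"
proof -
  have "finite (hanging k \<inter> leaves)" using finite_leaves by simp
  then have "boundary_count G x k = 0 \<longleftrightarrow> hanging k \<inter> leaves = {}"
    by (simp add: boundary_count_def verts_path_component[OF assms] boundary_eq_leaves)
  then show ?thesis
    using hanging_leafless_iff[OF assms] by simp
qed

text \<open>A leaf in \<open>hanging k\<close> has height \<open>k\<close>, which
  \<open>poincare_extremal\<close> confines to \<open>L / 2\<close>.\<close>

lemma boundary_count_outside_middle:
  assumes "poincare (arcs_ends G) leaves (2 / real L)" "0 < k" "k < L" "2 * k \<noteq> L"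
  shows "boundary_count G x k = 0"
proof -
  have "hanging k \<inter> leaves = {}"
  proof (rule ccontr)
    assume "\<not> ?thesis"
    then obtain v where v: "v \<in> hanging k" "v \<in> leaves" by blast
    then have "idx v = k" using idx_eq assms by simp
    moreover have "v \<noteq> x 0" "v \<noteq> x L"
      using \<open>idx v = k\<close> idx_x assms by auto
    ultimately show False
      using poincare_extremal[OF assms(1) v(2)] assms(4) by simp
  qed
  then show ?thesis
    by (simp add: boundary_count_def verts_path_component[OF assms(2,3)] boundary_eq_leaves)
qed

lemma union_of_path_and_component:
  assumes m: "0 < m" "m < L"
    and triv: "\<forall>k. 0 < k \<and> k < L \<and> k \<noteq> m \<longrightarrow> hanging k = {x k}"
  shows "G = Digraph_Component.union (induce_subgraph G (x ` {0..L})) (path_component G x m)"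
proof -
  have "verts G = x ` {0..L} \<union> hanging m"
  proof
    show "verts G \<subseteq> x ` {0..L} \<union> hanging m"
    proof
      fix v assume v: "v \<in> verts G"
      show "v \<in> x ` {0..L} \<union> hanging m"
      proof (cases "idx v = m")
        case True
        then show ?thesis using idx_props(2)[OF v] by simp
      next
        case False
        then have "hanging (idx v) = {x (idx v)}"
          using hanging_all_trivial[OF triv] idx_props(1)[OF v] by blast
        then show ?thesis using idx_props[OF v] by auto
      qed
    qed
    show "x ` {0..L} \<union> hanging m \<subseteq> verts G"
      using x_in_V hanging_subset[of m] m by auto
  qed
  moreover have "arcs G = {e \<in> arcs G. tail G e \<in> x ` {0..L} \<and> head G e \<in> x ` {0..L}} \<union>
      arcs (path_component G x m)"
  proof -
    have "tail G e \<in> x ` {0..L} \<and> head G e \<in> x ` {0..L} \<or> e \<in> arcs (path_component G x m)"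
      if e: "e \<in> arcs G" for e
    proof (cases "arc_to_ends G e \<in> off_path")
      case True
      then have "tail G e \<in> hanging m"
        using off_path_only[OF triv] by (simp add: arc_to_ends_def)
      then show ?thesis using e True by (simp add: arcs_path_component[OF m])
    next
      case False
      moreover have "arc_to_ends G e \<in> arcs_ends G" using e by (simp add: arcs_ends_def)
      ultimately have "(tail G e, head G e) \<in> path_edges"
        by (simp add: off_path_def arc_to_ends_def)
      then show ?thesis by (rule path_edge_ends) auto
    qed
    then show ?thesis by (auto simp: arcs_path_component[OF m])
  qed
  ultimately show ?thesis
    by (simp add: Digraph_Component.union_def induce_subgraph_def verts_path_component[OF m])
qed

text \<open>For a single vertex the leaf sum is empty and the Dirichlet inequality trivial, which
  matches the convention; otherwise a hanging leaf gives the double a nonempty boundary.\<close>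

lemma dirichlet_iff_wedge_double:
  assumes m: "0 < m" "m < L"
    and triv: "\<forall>k. 0 < k \<and> k < L \<and> k \<noteq> m \<longrightarrow> hanging k = {x k}"
    and c: "c \<ge> 0"
  shows "dirichlet off_path (leaves \<inter> hanging m) (x m) c \<longleftrightarrow>
    card (verts (path_component G x m)) = 1 \<or> c \<le> lambda2 (wedge_double (path_component G x m) (x m))"
proof (cases "hanging m = {x m}")
  case True
  then have "leaves \<inter> hanging m = {}" using inner_not_leaf[OF m] by auto
  then have "dirichlet off_path (leaves \<inter> hanging m) (x m) c"
    by (simp add: dirichlet_def energy_nonneg)
  then show ?thesis using True by (simp add: verts_path_component[OF m])
next
  case False
  interpret H: graph "path_component G x m" by (rule graph_path_component[OF m])
  have xm: "x m \<in> hanging m" by (simp add: hanging_def)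
  then have "card (verts (path_component G x m)) \<noteq> 1"
    using False by (auto simp: verts_path_component[OF m] card_1_singleton_iff)
  moreover have "arcs_ends (path_component G x m) = off_path"
    using off_path_only[OF triv] by (auto simp: arcs_ends_path_component[OF m])
  moreover have "leaves \<inter> hanging m \<noteq> {}"
    using hanging_has_leaf[OF _ False] m by auto
  ultimately show ?thesis
    using H.lambda2_wedge_double_ge_iff[of "x m" c] connected_path_component[OF m] c xm
    by (simp add: boundary_path_component[OF m] verts_path_component[OF m])
qed

lemma path_graph_iff:
  "(\<forall>k\<in>{1..L - 1}. boundary_count G x k = 0) \<longleftrightarrow> path_graph_of_length G L"
proof -
  have "(\<forall>k\<in>{1..L - 1}. boundary_count G x k = 0) \<longleftrightarrow> (\<forall>k. 0 < k \<and> k < L \<longrightarrow> hanging k = {x k})"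
    using boundary_count_eq_0_iff by (auto simp: Suc_le_eq)
  also have "\<dots> \<longleftrightarrow> verts G = x ` {0..L}"
    by (rule hanging_trivial_iff_path_covers)
  also have "\<dots> \<longleftrightarrow> path_graph_of_length G L"
  proof
    assume V: "verts G = x ` {0..L}"
    have "(x i, x j) \<in> arcs_ends G \<longleftrightarrow> j = i + 1 \<or> i = j + 1" if ij: "i \<le> L" "j \<le> L" for i j
    proof
      assume a: "(x i, x j) \<in> arcs_ends G"
      show "j = i + 1 \<or> i = j + 1"
      proof (cases "(x i, x j) \<in> off_path")
        case True
        then have "i = j" using idx_off_path idx_x ij by metis
        then show ?thesis using a irrefl_A by simp
      next
        case False
        then have "(x i, x j) \<in> path_edges" using a by (simp add: off_path_def)
        then show ?thesis using ij by (auto simp: path_edges_def x_eq_iff)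
      qed
    next
      assume "j = i + 1 \<or> i = j + 1"
      then show "(x i, x j) \<in> arcs_ends G"
        using path_edge path_edge' ij by auto
    qed
    then show "path_graph_of_length G L"
      unfolding path_graph_of_length_def using inj_path V by (auto simp: bij_betw_def)
  next
    assume "path_graph_of_length G L"
    \<comment> \<open>The enumeration in \<open>path_graph_of_length\<close> may differ from
      \<open>x\<close>; counting shows that \<open>x\<close> still exhausts the vertices.\<close>
    then have "card (verts G) = card {0..L}"
      unfolding path_graph_of_length_def using bij_betw_same_card by metis
    also have "\<dots> = card (x ` {0..L})"
      using inj_path by (simp add: card_image)
    finally show "verts G = x ` {0..L}"
      using x_in_V by (intro card_subset_eq[symmetric] finite_V) auto
  qed
  finally show ?thesis .
qed

section \<open>The two parities\<close>

lemma lambda2_eq_iff_odd: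
  assumes "odd L"
  shows "lambda2 G = 2 / real L \<longleftrightarrow> (\<forall>k\<in>{1..L - 1}. boundary_count G x k = 0)"
proof
  assume "lambda2 G = 2 / real L"
  then have "poincare (arcs_ends G) leaves (2 / real L)"
    by (simp add: lambda2_eq_iff)
  moreover have "2 * k \<noteq> L" for k using assms by auto
  ultimately show "\<forall>k\<in>{1..L - 1}. boundary_count G x k = 0"
    using boundary_count_outside_middle by auto
next
  assume "\<forall>k\<in>{1..L - 1}. boundary_count G x k = 0"
  then have "\<forall>k. 0 < k \<and> k < L \<longrightarrow> hanging k = {x k}"
    using boundary_count_eq_0_iff by (auto simp: Suc_le_eq)
  then show "lambda2 G = 2 / real L"
    using poincare_path by (simp add: lambda2_eq_iff)
qed

text \<open>If a component other than the middle one is nontrivial, both sides fail. Otherwise the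
  equality passes from \<open>poincare\<close> to \<open>dirichlet\<close> and from there to the
  double.\<close>

lemma lambda2_eq_iff_even:
  assumes L: "L = 2 * m"
  shows "lambda2 G = 2 / real L \<longleftrightarrow>
    (\<forall>k\<in>{1..L - 1}. k \<noteq> m \<longrightarrow> boundary_count G x k = 0) \<and>
    G = Digraph_Component.union (induce_subgraph G (x ` {0..L})) (path_component G x m) \<and>
    (card (verts (path_component G x m)) = 1 \<or>
      2 / real L \<le> lambda2 (wedge_double (path_component G x m) (x m)))"
proof -
  have m: "0 < m" "m < L" using L L_pos by auto
  have triv: "(\<forall>k\<in>{1..L - 1}. k \<noteq> m \<longrightarrow> boundary_count G x k = 0) \<longleftrightarrow>
      (\<forall>k. 0 < k \<and> k < L \<and> k \<noteq> m \<longrightarrow> hanging k = {x k})"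
    using boundary_count_eq_0_iff by (auto simp: Suc_le_eq)
  show ?thesis
  proof (cases "\<forall>k. 0 < k \<and> k < L \<and> k \<noteq> m \<longrightarrow> hanging k = {x k}")
    case True
    then show ?thesis
      unfolding triv lambda2_eq_iff
      using poincare_iff_dirichlet[OF L True]
        dirichlet_iff_wedge_double[OF m True, of "2 / real L"] union_of_path_and_component[OF m True]
      by simp
  next
    case False
    then have "\<not> poincare (arcs_ends G) leaves (2 / real L)"
      using boundary_count_outside_middle boundary_count_eq_0_iff L by auto
    then show ?thesis
      using False unfolding triv lambda2_eq_iff by blast
  qed
qed

end

theorem theorem5p2:
  fixes G :: "('a, 'b) pre_digraph" and L :: nat and x :: "nat \<Rightarrow> 'a"
  assumes "finite_tree G"
    and "L \<ge> 1"
    and "graph_diameter G = ereal (real L)"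
    and "\<forall>j\<le>L. x j \<in> verts G"
    and "\<forall>j<L. (x j, x (j + 1)) \<in> arcs_ends G"
    and "inj_on x {0..L}"
  shows
    "(lambda2 G = 2 / real L \<longleftrightarrow>
        (odd L \<and> (\<forall>k\<in>{1..L - 1}. boundary_count G x k = 0)) \<or>
        (even L \<and> (\<forall>k\<in>{1..L - 1}. k \<noteq> L div 2 \<longrightarrow> boundary_count G x k = 0) \<and>
         (let H\<^sub>1 = induce_subgraph G (x ` {0..L});
              H\<^sub>2 = path_component G x (L div 2)
          in G = Digraph_Component.union H\<^sub>1 H\<^sub>2 \<and>
             (card (verts H\<^sub>2) = 1 \<or> lambda2 (wedge_double H\<^sub>2 (x (L div 2))) \<ge> 2 / real L))))
     \<and> (odd L \<longrightarrow>
          ((\<forall>k\<in>{1..L - 1}. boundary_count G x k = 0) \<longleftrightarrow> path_graph_of_length G L))"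
proof -
  interpret graph G using finite_treeD assms(1) by blast
  interpret relational_tree "verts G" "arcs_ends G"
    by (rule finite_tree_relational[OF assms(1)])
  interpret tree_with_path "verts G" "arcs_ends G" L x
    using assms by unfold_locales auto
  \<comment> \<open>The diameter is used here: it bounds the oscillation of 1-Lipschitz functions by
    \<open>L\<close>, so both ends of the path are leaves.\<close>
  interpret steklov_tree G L x
    by unfold_locales (rule endpoints_are_leaves, rule lipschitz_le_diameter[OF assms(3)], blast+)+
  show ?thesis
  proof (cases "even L")
    case True
    then have L: "L = 2 * (L div 2)" by simp
    show ?thesis
      unfolding Let_def lambda2_eq_iff_even[OF L] using True by simp
  next
    case False
    then show ?thesis
      using lambda2_eq_iff_odd[OF False] path_graph_iff by simp
  qed
qed

end
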